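(* Suppose that $\mathsf{E}\{\xi\}=0$ and $\mathsf{E}\{\xi^2\}=1$, and that for all sufficiently large $x$ $$F(x+\Delta)=p(x)e^{-cx\log^{-\beta}x},$$ where $\beta>0$, $c>0$, and $p$ is intermediate regularly varying at infinity (hence $O$-regularly varying). Then for any sequence $\{x_n\}$ with $x_n\gg n^{1/(2\beta)}$, we have $\mathsf{P}\{S_n\in x+\Delta\}\sim nF(x+\Delta)$ as $n\to\infty$ uniformly for $x\ge\exp(x_n)$, that is, $$\lim_{n\to\infty}\ \sup_{x\ge\exp(x_n)}\left|\frac{\mathsf{P}\{S_n\in x+\Delta\}}{nF(x+\Delta)}-1\right|=0 .$$
   Context: Let $\xi,\xi_1,\xi_2,\dots$ be i.i.d. real random variables with distribution $F$, and $S_n=\xi_1+\cdots+\xi_n$. Fix $T\in(0,\infty]$; put $\Delta=(0,T]$ if $T<\infty$ and $\Delta=(0,\infty)$ if $T=\infty$, and $F(x+\Delta)=\mathsf{P}\{\xi\in x+\Delta\}$ (so $F(x+\Delta)=\mathsf{P}\{\xi>x\}$ when $T=\infty$). $\log^{-\beta}x$ means $(\log x)^{-\beta}$; $f\gg g$ means $g/f\to0$. Let $p$ be a positive measurable function defined near infinity. It is $O$-regularly varying if $0<\liminf_{x\to\infty}p(xy)/p(x)\le\limsup_{x\to\infty}p(xy)/p(x)<\infty$ for every $y\ge1$; intermediate regularly varying if $\lim_{y\downarrow1}\liminf_{x\to\infty}p(xy)/p(x)=\lim_{y\downarrow1}\limsup_{x\to\infty}p(xy)/p(x)=1$ (this implies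 $O$-regular variation). *)

theory Defs
  imports "HOL-Probability.Probability"
begin

(* T = \<infinity> is allowed and gives the open half-line {0<..}. *)
definition Delta :: "ereal \<Rightarrow> real set" where
  "Delta T = {t. 0 < t \<and> ereal t \<le> T}"

definition shifted_Delta :: "ereal \<Rightarrow> real \<Rightarrow> real set" where
  "shifted_Delta T x = (\<lambda>t. x + t) ` Delta T"

(* Only the values of p near infinity matter; p is total with arbitrary values elsewhere. *)
definition positive_measurable_near_infinity :: "(real \<Rightarrow> real) \<Rightarrow> bool" where
  "positive_measurable_near_infinity p \<longleftrightarrow>
     (\<exists>a. (\<forall>x\<ge>a. 0 < p x) \<and> p \<in> borel_measurable (restrict_space borel {a..}))"

(* The lower and upper limits are taken in the extended reals, so that they always exist. *)
definition intermediate_regularly_varying :: "(real \<Rightarrow> real) \<Rightarrow> bool" where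
  "intermediate_regularly_varying p \<longleftrightarrow>
     positive_measurable_near_infinity p \<and>
     ((\<lambda>y. Liminf at_top (\<lambda>x. ereal (p (x * y) / p x))) \<longlongrightarrow> 1) (at_right 1) \<and>
     ((\<lambda>y. Limsup at_top (\<lambda>x. ereal (p (x * y) / p x))) \<longlongrightarrow> 1) (at_right 1)"

(* f \<gg> g. The relation compares positive sequences: without eventual positivity of f,
   the limit of the quotient would also admit sequences f tending to minus infinity
   (and, since division by zero gives 0, f = 0). *)
definition much_greater :: "(nat \<Rightarrow> real) \<Rightarrow> (nat \<Rightarrow> real) \<Rightarrow> bool" where
  "much_greater f g \<longleftrightarrow> (\<forall>\<^sub>F n in sequentially. 0 < f n) \<and> (\<lambda>n. g n / f n) \<longlonglongrightarrow> 0"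

(* xi 0 is the generic copy of the summands; it does not enter the partial sums. *)
definition iid_with_distribution :: "'a measure \<Rightarrow> (nat \<Rightarrow> 'a \<Rightarrow> real) \<Rightarrow> real measure \<Rightarrow> bool" where
  "iid_with_distribution M \<xi> F \<longleftrightarrow>
     prob_space M \<and> prob_space.indep_vars M (\<lambda>_. borel) \<xi> UNIV \<and>
     (\<forall>i. distr M borel (\<xi> i) = F)"

definition partial_sum :: "(nat \<Rightarrow> 'a \<Rightarrow> real) \<Rightarrow> nat \<Rightarrow> 'a \<Rightarrow> real" where
  "partial_sum \<xi> n \<omega> = (\<Sum>i=1..n. \<xi> i \<omega>)"

end

(* The tail is exp(-h x) up to p, with h x = c x / (ln x)^beta of slope of order 1 / L,
   L = (ln x)^beta, so it is insensitive to shifts that are o(L). As n = o(L^2), the sum of n - 1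
   summands, of order sqrt n, is such a shift, and a single big jump gives n F(x + Delta).

   Lower bound: the events "summand i makes S_n hit x + Delta, the rest is at most y in modulus,
   all other summands are at most x/2", with sqrt n << y << L, are disjoint.

   Upper bound: if no summand exceeds x/2, the exponential Markov inequality is applied with a
   tilt s slightly larger than h x / x, namely s = (c / L)(1 + eta / ln x). Below x/2 the exponent
   h u exceeds s u by enough for E(exp(s xi); xi <= x/2) <= 1 + O(1/L^2), so that the n-th power
   stays bounded. If summand i exceeds x/2, condition on the sum S' of the others:
   h x - h(x - u) <= c u / L reduces the contribution of S' > y to E(exp(c S'/L); S' > y), which is
   small because the whole truncated expectation is at most 1 + o(1) while its part over
   |S'| <= y is already at least 1 - o(1). *)
theory Submission
  imports Defs "HOL-Real_Asymp.Real_Asymp"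
begin

text \<open>For finite \<open>T\<close> only windows are controlled, so \<open>G\<close> need not be
  monotone and tail integrals are not directly available; moments of F are therefore computed from
  cells. The factor p enters twice: it is almost constant under shifts that are o(x), and globally
  it distorts by at most a power. Powers are absorbed by a weight x^q, which is harmless beside
  exp(h x). The order 1/L^2 is forced: only n = o(L^2) is known, so an n-th power of 1 + O(1/L^2)
  tends to 1. Centering and unit variance give 1 + s^2 near the origin, and the range beyond 1/s
  must contribute no more; hence the recurring target -2 \<beta> ln ln x = ln(1/L^2). Two tilts are
  needed. The tilt c/L matches the decrease of h exactly and serves after conditioning on the other
  summands. It fails when no jump occurs, because exp(-(c/L) x) / G x = 1 / p x need not vanish. The
  extra factor 1 + \<eta> / ln x gains exp(-c \<eta> x / (L ln x)), which beats every power.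
  Truncation at x/2 makes room for it: there h u / u exceeds c/L by a relative amount of at least
  \<beta> ln 2 / ln x, and \<eta> = \<beta> ln 2 / 2 spends half of that.\<close>

section \<open>Uniformity and Potter bounds for intermediate regular variation\<close>

text \<open>The pointwise oscillation bound becomes uniform by a Steinhaus argument: along a sequence of
  counterexamples \<open>t k\<close>, \<open>u k\<close>, the good increments from \<open>t k\<close> and the translated good increments
  from \<open>t k + u k\<close> have too much measure together to be disjoint.\<close>

lemma uniform_small_oscillation:
  fixes \<phi> :: "real \<Rightarrow> real"
  assumes meas: "\<phi> \<in> borel_measurable borel" and \<delta>: "0 < \<delta>"
    and osc: "\<And>u. 0 < u \<Longrightarrow> u < 2 * \<delta> \<Longrightarrow> \<forall>\<^sub>F t in at_top. \<bar>\<phi> (t + u) - \<phi> t\<bar> \<le> \<epsilon>"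
  shows "\<exists>b. \<forall>t\<ge>b. \<forall>u\<in>{0..\<delta>}. \<bar>\<phi> (t + u) - \<phi> t\<bar> \<le> 2 * \<epsilon>"
proof (rule ccontr)
  assume "\<not> ?thesis"
  then have "\<forall>k::nat. \<exists>t u. t \<ge> real k \<and> u \<in> {0..\<delta>} \<and> \<bar>\<phi> (t + u) - \<phi> t\<bar> > 2 * \<epsilon>"
    by (meson not_le)
  then obtain t u where tu: "\<And>k::nat. t k \<ge> real k \<and> u k \<in> {0..\<delta>} \<and> \<bar>\<phi> (t k + u k) - \<phi> (t k)\<bar> > 2 * \<epsilon>"
    by metis
  have t_lim: "filterlim t at_top sequentially"
    by (rule filterlim_at_top_mono[OF filterlim_real_sequentially]) (use tu in auto)
  have tu_lim: "filterlim (\<lambda>k. t k + u k) at_top sequentially"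
    by (rule filterlim_at_top_mono[OF filterlim_real_sequentially])
       (use tu in \<open>auto intro!: eventuallyI add_increasing2\<close>)
  have large: "\<exists>N0. \<forall>N\<ge>N0. emeasure lborel {v\<in>{0<..<b}. \<forall>k\<ge>N. \<bar>\<phi> (r k + v) - \<phi> (r k)\<bar> \<le> \<epsilon>} > b - \<delta> / 3"
    if r: "filterlim r at_top sequentially" and b: "b \<le> 2 * \<delta>" "\<delta> \<le> b" for r :: "nat \<Rightarrow> real" and b
  proof -
    define A where "A N = {v\<in>{0<..<b}. \<forall>k\<ge>N. \<bar>\<phi> (r k + v) - \<phi> (r k)\<bar> \<le> \<epsilon>}" for N :: nat
    have [measurable]: "\<phi> \<in> borel_measurable borel" by (rule meas)
    have "A N \<in> sets borel" for N
      unfolding A_def by measurable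
    then have rng: "range A \<subseteq> sets lborel" by auto
    have inc: "incseq A" by (auto simp: A_def incseq_def)
    have UN: "(\<Union>N. A N) = {0<..<b}"
    proof (intro equalityI subsetI)
      fix v assume v: "v \<in> {0<..<b}"
      have "\<forall>\<^sub>F k in sequentially. \<bar>\<phi> (r k + v) - \<phi> (r k)\<bar> \<le> \<epsilon>"
        using filterlim_iff[THEN iffD1, OF r, rule_format, OF osc[of v]] v b by auto
      then show "v \<in> (\<Union>N. A N)" using v by (auto simp: A_def eventually_sequentially)
    qed (auto simp: A_def)
    have "(\<lambda>N. emeasure lborel (A N)) \<longlonglongrightarrow> emeasure lborel (\<Union>N. A N)"
      by (rule Lim_emeasure_incseq[OF rng inc])
    then have "(\<lambda>N. emeasure lborel (A N)) \<longlonglongrightarrow> ennreal b"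
      using b \<delta> by (simp add: UN)
    moreover have "ennreal (b - \<delta> / 3) < ennreal b" using b \<delta> by (simp add: ennreal_less_iff)
    ultimately have "\<forall>\<^sub>F N in sequentially. emeasure lborel (A N) > ennreal (b - \<delta> / 3)"
      by (rule order_tendstoD(1))
    then show ?thesis by (auto simp: A_def eventually_sequentially)
  qed
  obtain N1 where N1: "\<And>N. N \<ge> N1 \<Longrightarrow> emeasure lborel {v\<in>{0<..<2*\<delta>}. \<forall>k\<ge>N. \<bar>\<phi> (t k + v) - \<phi> (t k)\<bar> \<le> \<epsilon>} > 2*\<delta> - \<delta> / 3"
    using large[OF t_lim, of "2*\<delta>"] \<delta> by auto
  obtain N2 where N2: "\<And>N. N \<ge> N2 \<Longrightarrow> emeasure lborel {v\<in>{0<..<\<delta>}. \<forall>k\<ge>N. \<bar>\<phi> (t k + u k + v) - \<phi> (t k + u k)\<bar> \<le> \<epsilon>} > \<delta> - \<delta> / 3"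
    using large[OF tu_lim, of "\<delta>"] \<delta> by auto
  define N where "N = max N1 N2"
  define A where "A = {v\<in>{0<..<2*\<delta>}. \<forall>k\<ge>N. \<bar>\<phi> (t k + v) - \<phi> (t k)\<bar> \<le> \<epsilon>}"
  define B where "B = {v\<in>{0<..<\<delta>}. \<forall>k\<ge>N. \<bar>\<phi> (t k + u k + v) - \<phi> (t k + u k)\<bar> \<le> \<epsilon>}"
  \<comment> \<open>This is \<open>B\<close> translated by \<open>u N\<close>. It still lies in
    \<open>{0..2*\<delta>}\<close>, which is why the hypothesis reaches 2\<delta> while the
    conclusion stops at \<delta>. A common point of \<open>A\<close> and \<open>B'\<close> would
    compare both \<open>t N\<close> and \<open>t N + u N\<close> with the same third point. The
    losses \<delta>/3 leave a total mass of 7\<delta>/3 > 2\<delta>.\<close>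
  define B' where "B' = (\<lambda>v. - u N + v) -` B"
  have A: "emeasure lborel A > 2*\<delta> - \<delta> / 3" unfolding A_def by (rule N1) (simp add: N_def)
  have B: "emeasure lborel B > \<delta> - \<delta> / 3" unfolding B_def by (rule N2) (simp add: N_def)
  have [measurable]: "\<phi> \<in> borel_measurable borel" by (rule meas)
  have Am [measurable]: "A \<in> sets borel" unfolding A_def by measurable
  have Bm [measurable]: "B \<in> sets borel" unfolding B_def by measurable
  have B'm: "B' \<in> sets borel"
    unfolding B'_def by (rule measurable_sets_borel[OF _ Bm]) measurable
  have "emeasure lborel B = emeasure (distr lborel borel ((+) (- u N))) B"
    by (subst lborel_distr_plus) simp
  also have "\<dots> = emeasure lborel B'"
    by (subst emeasure_distr) (auto simp: B'_def simp del: add_uminus_conv_diff uminus_add_conv_diff)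
  finally have B': "emeasure lborel B' > \<delta> - \<delta> / 3" using B by simp
  have "A \<inter> B' = {}"
  proof (rule ccontr)
    assume "A \<inter> B' \<noteq> {}"
    then obtain v where "v \<in> A" "v \<in> B'" by auto
    then have "\<bar>\<phi> (t N + v) - \<phi> (t N)\<bar> \<le> \<epsilon>"
      "\<bar>\<phi> (t N + u N + (- u N + v)) - \<phi> (t N + u N)\<bar> \<le> \<epsilon>"
      by (auto simp: A_def B'_def B_def)
    moreover have "t N + u N + (- u N + v) = t N + v" by simp
    ultimately have "\<bar>\<phi> (t N + v) - \<phi> (t N)\<bar> \<le> \<epsilon>"
      "\<bar>\<phi> (t N + v) - \<phi> (t N + u N)\<bar> \<le> \<epsilon>" by (simp_all only:)
    then show False using tu[of N] by linarith
  qed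
  then have "emeasure lborel A + emeasure lborel B' = emeasure lborel (A \<union> B')"
    using Am B'm by (intro plus_emeasure) auto
  also have "\<dots> \<le> emeasure lborel {0..2*\<delta>}"
    using tu[of N] by (intro emeasure_mono) (auto simp: A_def B'_def B_def)
  also have "\<dots> = ennreal (2 * \<delta>)" using \<delta> by simp
  finally have "emeasure lborel A + emeasure lborel B' \<le> ennreal (2 * \<delta>)" .
  moreover have "ennreal (2*\<delta> - \<delta>/3) + ennreal (\<delta> - \<delta>/3) \<le> emeasure lborel A + emeasure lborel B'"
    using A B' by (intro add_mono less_imp_le) auto
  moreover have "ennreal (2*\<delta> - \<delta>/3) + ennreal (\<delta> - \<delta>/3) = ennreal (7/3 * \<delta>)"
    using \<delta> by (subst ennreal_plus[symmetric]) auto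
  ultimately have "ennreal (7/3 * \<delta>) \<le> ennreal (2 * \<delta>)" by simp
  then show False using \<delta> by simp
qed

text \<open>Chaining: u is exhausted by floor(u/\<delta>) + 1 steps of length at most \<delta>, each
  costing \<epsilon>. In the logarithmic scale the slope \<epsilon>/\<delta> becomes the exponent of
  a Potter bound.\<close>

lemma linear_oscillation:
  fixes \<phi> :: "real \<Rightarrow> real"
  assumes \<delta>: "0 < \<delta>" and "0 \<le> \<epsilon>"
    and osc: "\<And>t u. b \<le> t \<Longrightarrow> u \<in> {0..\<delta>} \<Longrightarrow> \<bar>\<phi> (t + u) - \<phi> t\<bar> \<le> \<epsilon>"
    and "b \<le> t" "0 \<le> u"
  shows "\<bar>\<phi> (t + u) - \<phi> t\<bar> \<le> \<epsilon> + \<epsilon> / \<delta> * u"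
proof -
  have step: "\<bar>\<phi> (t + u) - \<phi> t\<bar> \<le> \<epsilon> * real (Suc k)" if "0 \<le> u" "u \<le> \<delta> * real (Suc k)" for u and k :: nat
    using that
  proof (induction k arbitrary: u)
    case 0
    then show ?case using osc[of t u] assms by auto
  next
    case (Suc k)
    show ?case
    proof (cases "u \<le> \<delta>")
      case True
      have "\<bar>\<phi> (t + u) - \<phi> t\<bar> \<le> \<epsilon> * 1" using osc[of t u] assms True Suc by auto
      also have "\<dots> \<le> \<epsilon> * real (Suc (Suc k))" using assms by (intro mult_left_mono) auto
      finally show ?thesis .
    next
      case False
      have "\<bar>\<phi> (t + (u - \<delta>)) - \<phi> t\<bar> \<le> \<epsilon> * real (Suc k)"
        using Suc.prems False by (intro Suc.IH) (auto simp: algebra_simps)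
      moreover have "\<bar>\<phi> (t + (u - \<delta>) + \<delta>) - \<phi> (t + (u - \<delta>))\<bar> \<le> \<epsilon>"
        using False assms Suc.prems by (intro osc) auto
      ultimately show ?thesis by (simp add: algebra_simps)
    qed
  qed
  define k where "k = nat \<lfloor>u / \<delta>\<rfloor>"
  have k: "real k \<le> u / \<delta>" "u / \<delta> \<le> real (Suc k)"
    using assms by (auto simp: k_def) (use assms in linarith)+
  have "\<bar>\<phi> (t + u) - \<phi> t\<bar> \<le> \<epsilon> * real (Suc k)"
    using k \<delta> \<open>0 \<le> u\<close> by (intro step) (auto simp: field_simps)
  also have "\<dots> \<le> \<epsilon> * (1 + u / \<delta>)" using k assms by (intro mult_left_mono) auto
  finally show ?thesis by (simp add: algebra_simps)
qed

text \<open>Passing to t = ln x and u = ln y turns dilations into translations, so that the additive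
  uniformity result applies to ln p(exp t). The limits y \<down> 1 of the lower and upper limits
  provide one interval (1, d) on which every fixed y is good.\<close>

lemma irv_log_oscillation:
  assumes irv: "intermediate_regularly_varying p" and \<epsilon>: "0 < \<epsilon>"
  shows "\<exists>\<delta>>0. \<exists>t0. (\<forall>t\<ge>t0. 0 < p (exp t)) \<and>
    (\<forall>t\<ge>t0. \<forall>u\<in>{0..\<delta>}. \<bar>ln (p (exp (t + u))) - ln (p (exp t))\<bar> \<le> \<epsilon>)"
proof -
  obtain a where a: "\<And>x. x \<ge> a \<Longrightarrow> 0 < p x" and pm: "p \<in> borel_measurable (restrict_space borel {a..})"
    and Li: "((\<lambda>y. Liminf at_top (\<lambda>x. ereal (p (x * y) / p x))) \<longlongrightarrow> 1) (at_right 1)"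
    and Ls: "((\<lambda>y. Limsup at_top (\<lambda>x. ereal (p (x * y) / p x))) \<longlongrightarrow> 1) (at_right 1)"
    using irv unfolding intermediate_regularly_varying_def positive_measurable_near_infinity_def by auto
  \<comment> \<open>p is measurable only near infinity; the constant 1 elsewhere gives a globally
    measurable and positive function.\<close>
  define p' where "p' x = (if x \<in> {a..} \<inter> space borel then p x else 1)" for x
  have [measurable]: "p' \<in> borel_measurable borel"

    unfolding p'_def by (subst measurable_restrict_space_iff[symmetric]) (use pm in auto)
  define \<phi> where "\<phi> t = ln (p' (exp t))" for t
  have \<phi>m: "\<phi> \<in> borel_measurable borel" unfolding \<phi>_def by measurable
  have "\<forall>\<^sub>F y in at_right 1. Liminf at_top (\<lambda>x. ereal (p (x * y) / p x)) > ereal (exp (- \<epsilon> / 2))"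
    by (rule order_tendstoD(1)[OF Li]) (use \<epsilon> in \<open>simp add: one_ereal_def\<close>)
  moreover have "\<forall>\<^sub>F y in at_right 1. Limsup at_top (\<lambda>x. ereal (p (x * y) / p x)) < ereal (exp (\<epsilon> / 2))"
    by (rule order_tendstoD(2)[OF Ls]) (use \<epsilon> in \<open>simp add: one_ereal_def\<close>)
  ultimately have "\<forall>\<^sub>F y in at_right 1. Liminf at_top (\<lambda>x. ereal (p (x * y) / p x)) > ereal (exp (- \<epsilon> / 2)) \<and>
      Limsup at_top (\<lambda>x. ereal (p (x * y) / p x)) < ereal (exp (\<epsilon> / 2))"
    by eventually_elim auto
  then obtain d where d: "d > 1" and
    Ld: "\<And>y. 1 < y \<Longrightarrow> y < d \<Longrightarrow> Liminf at_top (\<lambda>x. ereal (p (x * y) / p x)) > ereal (exp (- \<epsilon> / 2)) \<and>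
      Limsup at_top (\<lambda>x. ereal (p (x * y) / p x)) < ereal (exp (\<epsilon> / 2))"
    unfolding eventually_at_right_field by blast
  \<comment> \<open>Half of ln d, since \<open>uniform_small_oscillation\<close> consumes increments
    up to twice the \<delta> that it delivers.\<close>
  define \<delta> where "\<delta> = ln d / 2"
  have \<delta>: "\<delta> > 0" using d by (simp add: \<delta>_def)
  have "\<exists>t0. \<forall>t\<ge>t0. \<forall>u\<in>{0..\<delta>}. \<bar>\<phi> (t + u) - \<phi> t\<bar> \<le> 2 * (\<epsilon> / 2)"
  proof (rule uniform_small_oscillation[OF \<phi>m \<delta>])
    fix u assume u: "0 < u" "u < 2 * \<delta>"
    have eu: "1 < exp u" "exp u < d" using u d by (auto simp: \<delta>_def) (metis exp_less_cancel_iff exp_ln less_trans zero_less_one)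
    have "\<forall>\<^sub>F x in at_top. ereal (exp (- \<epsilon> / 2)) < ereal (p (x * exp u) / p x)"
      using Ld[OF eu] by (intro less_LiminfD) auto
    moreover have "\<forall>\<^sub>F x in at_top. ereal (p (x * exp u) / p x) < ereal (exp (\<epsilon> / 2))"
      using Ld[OF eu] by (intro Limsup_lessD) auto
    ultimately have "\<forall>\<^sub>F x in at_top. exp (- \<epsilon> / 2) < p (x * exp u) / p x \<and> p (x * exp u) / p x < exp (\<epsilon> / 2)"
      by eventually_elim auto
    then have "\<forall>\<^sub>F t in at_top. exp (- \<epsilon> / 2) < p (exp t * exp u) / p (exp t) \<and> p (exp t * exp u) / p (exp t) < exp (\<epsilon> / 2)"
      by (rule filterlim_iff[THEN iffD1, OF exp_at_top, rule_format])
    moreover have "\<forall>\<^sub>F t in at_top. exp t \<ge> max a 0"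
      by (rule filterlim_at_top[THEN iffD1, OF exp_at_top, rule_format])
    ultimately show "\<forall>\<^sub>F t in at_top. \<bar>\<phi> (t + u) - \<phi> t\<bar> \<le> \<epsilon> / 2"
    proof eventually_elim
      case (elim t)
      have ge: "exp t * exp u \<ge> a"
        using elim mult_left_mono[OF less_imp_le[OF eu(1)] exp_ge_zero[of t]] by linarith
      have pos: "0 < p (exp t)" "0 < p (exp t * exp u)" using elim a ge by auto
      have eq: "\<phi> (t + u) - \<phi> t = ln (p (exp t * exp u) / p (exp t))"
        using elim ge pos by (auto simp: \<phi>_def p'_def exp_add ln_div)
      have "ln (exp (- \<epsilon> / 2)) < ln (p (exp t * exp u) / p (exp t))" "ln (p (exp t * exp u) / p (exp t)) < ln (exp (\<epsilon> / 2))"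
        using elim(1) pos by (subst ln_less_cancel_iff; simp)+
      then show ?case unfolding eq by auto
    qed
  qed
  then obtain t0 where "\<forall>t\<ge>t0. \<forall>u\<in>{0..\<delta>}. \<bar>\<phi> (t + u) - \<phi> t\<bar> \<le> 2 * (\<epsilon> / 2)" by blast
  then have t0: "\<bar>\<phi> (t + u) - \<phi> t\<bar> \<le> \<epsilon>" if "t \<ge> t0" "u \<in> {0..\<delta>}" for t u
    using that by simp
  define t1 where "t1 = max t0 (ln (max a 1))"
  have ge: "exp t \<ge> a" if "t \<ge> t1" for t
  proof -
    have "a \<le> exp (ln (max a 1))" by simp
    also have "\<dots> \<le> exp t" using that by (subst exp_le_cancel_iff) (simp add: t1_def)
    finally show ?thesis .
  qed
  have "\<bar>ln (p (exp (t + u))) - ln (p (exp t))\<bar> \<le> \<epsilon>" if "t \<ge> t1" "u \<in> {0..\<delta>}" for t u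
    using t0[of t u] that ge[of t] ge[of "t + u"] by (auto simp: \<phi>_def p'_def t1_def)
  moreover have "0 < p (exp t)" if "t \<ge> t1" for t
    using ge[OF that] a by auto
  ultimately show ?thesis using \<delta> by (intro exI[of _ \<delta>] conjI exI[of _ t1]) auto
qed

text \<open>The exponentiated form of the oscillation bound; the window fits because ln (1 +
  \<delta>) \<le> \<delta>.\<close>

lemma irv_uniform:
  assumes irv: "intermediate_regularly_varying p" and \<epsilon>: "0 < \<epsilon>"
  shows "\<exists>\<delta>>0. \<exists>X. \<forall>x\<ge>X. \<forall>y\<in>{x..(1 + \<delta>) * x}. p y \<le> exp \<epsilon> * p x \<and> p x \<le> exp \<epsilon> * p y"
proof -
  obtain \<delta> t0 where \<delta>: "\<delta> > 0" and pos: "\<And>t. t \<ge> t0 \<Longrightarrow> 0 < p (exp t)"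
    and osc: "\<And>t u. t \<ge> t0 \<Longrightarrow> u \<in> {0..\<delta>} \<Longrightarrow> \<bar>ln (p (exp (t + u))) - ln (p (exp t))\<bar> \<le> \<epsilon>"
    using irv_log_oscillation[OF assms] by metis
  have "p y \<le> exp \<epsilon> * p x \<and> p x \<le> exp \<epsilon> * p y" if x: "x \<ge> exp t0" and y: "y \<in> {x..(1 + \<delta>) * x}" for x y
  proof -
    have x0: "0 < x" using x by (meson exp_gt_zero less_le_trans)
    have y0: "0 < y" using x0 y by auto
    have "y / x \<le> 1 + \<delta>" using y x0 by (auto simp: field_simps)
    also have "\<dots> \<le> exp \<delta>" by (rule exp_ge_add_one_self)
    finally have "ln (y / x) \<le> \<delta>"
      by (metis divide_pos_pos exp_gt_zero ln_exp ln_le_cancel_iff x0 y0)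
    moreover have "ln (y / x) \<ge> 0" using x0 y0 y by auto
    moreover have lx: "ln x \<ge> t0" using x x0 by (simp add: ln_ge_iff)
    ultimately have "\<bar>ln (p (exp (ln x + ln (y / x)))) - ln (p (exp (ln x)))\<bar> \<le> \<epsilon>"
      by (intro osc) auto
    moreover have "exp (ln x + ln (y / x)) = y" using x0 y0 by (simp add: exp_add)
    ultimately have *: "\<bar>ln (p y) - ln (p x)\<bar> \<le> \<epsilon>" using x0 by simp
    have "ln y \<ge> t0" using y x0 y0 by (intro order_trans[OF lx] ln_le_cancel_iff[THEN iffD2]) auto
    then have px: "0 < p x" "0 < p y" using pos[OF lx] pos[of "ln y"] x0 y0 by auto
    have "p y = exp (ln (p y))" using px by simp
    also have "\<dots> \<le> exp (\<epsilon> + ln (p x))" using * by (subst exp_le_cancel_iff) auto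
    finally have 1: "p y \<le> exp \<epsilon> * p x" using px by (simp add: exp_add)
    have "p x = exp (ln (p x))" using px by simp
    also have "\<dots> \<le> exp (\<epsilon> + ln (p y))" using * by (subst exp_le_cancel_iff) auto
    finally have 2: "p x \<le> exp \<epsilon> * p y" using px by (simp add: exp_add)
    show ?thesis using 1 2 by simp
  qed
  then show ?thesis using \<delta> by blast
qed

text \<open>Oscillation bound with \<epsilon> = 1, chained: |ln p y - ln p x| \<le> 1 + (1/\<delta>)
  ln (y/x), so K = e and a = 1/\<delta>. No control of the size of a is required, as every power is
  dominated by the exponential factor.\<close>

lemma irv_potter:
  assumes irv: "intermediate_regularly_varying p"
  shows "\<exists>K a X. 1 \<le> K \<and> 0 \<le> a \<and> 1 \<le> X \<and> (\<forall>x\<ge>X. 0 < p x \<and>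
    (\<forall>y\<ge>x. p y \<le> K * (y / x) powr a * p x \<and> p x \<le> K * (y / x) powr a * p y))"
proof -
  obtain \<delta> t0 where \<delta>: "\<delta> > 0" and pos: "\<And>t. t \<ge> t0 \<Longrightarrow> 0 < p (exp t)"
    and osc: "\<And>t u. t \<ge> t0 \<Longrightarrow> u \<in> {0..\<delta>} \<Longrightarrow> \<bar>ln (p (exp (t + u))) - ln (p (exp t))\<bar> \<le> 1"
    using irv_log_oscillation[OF assms zero_less_one] by metis
  define a where "a = 1 / \<delta>"
  have "0 < p x \<and> (\<forall>y\<ge>x. p y \<le> exp 1 * (y / x) powr a * p x \<and> p x \<le> exp 1 * (y / x) powr a * p y)"
    if x: "x \<ge> exp (max t0 0)" for x
  proof (intro conjI allI impI)
    have x0: "0 < x" using x by (meson exp_gt_zero less_le_trans)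
    have lx: "ln x \<ge> t0" using x x0 by (metis ln_ge_iff max.bounded_iff)
    show px: "0 < p x" using pos[OF lx] x0 by auto
    fix y assume y: "y \<ge> x"
    have y0: "0 < y" using x0 y by auto
    have "ln (y / x) \<ge> 0" using x0 y0 y by auto
    then have "\<bar>ln (p (exp (ln x + ln (y / x)))) - ln (p (exp (ln x)))\<bar> \<le> 1 + 1 / \<delta> * ln (y / x)"
      using linear_oscillation[where b = t0 and \<phi> = "\<lambda>t. ln (p (exp t))", OF \<delta> _ osc lx] by simp
    moreover have "exp (ln x + ln (y / x)) = y" using x0 y0 by (simp add: exp_add)
    ultimately have *: "\<bar>ln (p y) - ln (p x)\<bar> \<le> 1 + a * ln (y / x)" using x0 by (simp add: a_def)
    have E: "exp 1 * (y / x) powr a = exp (1 + a * ln (y / x))"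
      using x0 y0 by (simp add: powr_def exp_add)
    have "ln y \<ge> t0" using y x0 y0 by (intro order_trans[OF lx] ln_le_cancel_iff[THEN iffD2]) auto
    then have py: "0 < p y" using pos[of "ln y"] y0 by auto
    have "p y = exp (ln (p y))" using py by simp
    also have "\<dots> \<le> exp (1 + a * ln (y / x) + ln (p x))" using * by (subst exp_le_cancel_iff) auto
    finally show "p y \<le> exp 1 * (y / x) powr a * p x" using px by (simp only: E exp_add exp_ln)
    have "p x = exp (ln (p x))" using px by simp
    also have "\<dots> \<le> exp (1 + a * ln (y / x) + ln (p y))" using * by (subst exp_le_cancel_iff) auto
    finally show "p x \<le> exp 1 * (y / x) powr a * p y" using py by (simp only: E exp_add exp_ln)
  qed
  moreover have "1 \<le> exp (1::real)" "0 \<le> a" "1 \<le> exp (max t0 0)" using \<delta> by (auto simp: a_def)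
  ultimately show ?thesis by blast
qed

section \<open>The exponent of the tail\<close>

definition hazard :: "real \<Rightarrow> real \<Rightarrow> real \<Rightarrow> real" where
  "hazard c \<beta> x = c * x * ln x powr (- \<beta>)"

text \<open>The ratio h x / x is decreasing, so h(x - y) \<ge> (x - y) h x / x. There is no error
  term, and this makes c/L the right tilt after conditioning.\<close>

lemma hazard_diff_le:
  assumes "0 < c" "0 < \<beta>" "0 \<le> y" "1 < x - y"
  shows "hazard c \<beta> x - hazard c \<beta> (x - y) \<le> c * y / ln x powr \<beta>"
proof -
  have "ln x powr (-\<beta>) \<le> ln (x - y) powr (-\<beta>)"
    using assms by (intro powr_mono2') auto
  then have "c * (x - y) * ln x powr (-\<beta>) \<le> c * (x - y) * ln (x - y) powr (-\<beta>)"
    using assms by (intro mult_left_mono) auto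
  then show ?thesis by (simp add: hazard_def powr_minus_divide algebra_simps diff_divide_distrib)
qed

text \<open>The derivative is c (ln x)^(-\<beta>) (1 - \<beta> / ln x) - q / x, and a power of the
  logarithm dominates 1/x. The term q ln x serves to absorb the power in the Potter bounds.\<close>

lemma hazard_minus_ln_mono:
  fixes c \<beta> q :: real
  assumes "0 < c" "0 < \<beta>"
  shows "\<exists>Y>1. \<forall>u\<ge>Y. \<forall>v\<ge>u. hazard c \<beta> u - q * ln u \<le> hazard c \<beta> v - q * ln v"
proof -
  have "\<forall>\<^sub>F x in at_top. c * ln x powr (-\<beta>) - c * \<beta> * ln x powr (-\<beta> - 1) - q / x \<ge> 0"
    using assms by real_asymp
  then obtain Y where Y: "\<And>x. x \<ge> Y \<Longrightarrow> c * ln x powr (-\<beta>) - c * \<beta> * ln x powr (-\<beta> - 1) - q / x \<ge> 0"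
    unfolding eventually_at_top_linorder by auto
  have "hazard c \<beta> u - q * ln u \<le> hazard c \<beta> v - q * ln v" if u: "u \<ge> max Y 2" and v: "v \<ge> u" for u v
  proof (rule DERIV_nonneg_imp_nondecreasing[OF v])
    fix x assume x: "u \<le> x" "x \<le> v"
    have "((\<lambda>x. hazard c \<beta> x - q * ln x) has_real_derivative
       c * ln x powr (-\<beta>) - c * \<beta> * ln x powr (-\<beta> - 1) - q / x) (at x)"
      unfolding hazard_def using x u
      by (auto intro!: derivative_eq_intros simp: field_simps powr_diff)
    then show "\<exists>y. ((\<lambda>x. hazard c \<beta> x - q * ln x) has_real_derivative y) (at x) \<and> 0 \<le> y"
      using Y[of x] x u by (intro exI conjI) auto
  qed
  then show ?thesis by (intro exI[of _ "max Y 2"]) auto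
qed

text \<open>Bernoulli's inequality with exponent -\<beta> at the base v/l, hence valid for every
  \<beta> \<ge> 0 without a case distinction at 1. It is applied with l = ln x and v = ln u.\<close>

lemma powr_ge_one_plus:
  fixes l v \<beta> :: real
  assumes "0 < v" "0 < l" "0 \<le> \<beta>"
  shows "1 + \<beta> * (l - v) / l \<le> (l / v) powr \<beta>"
proof -
  have "ln (v / l) \<le> v / l - 1" using assms by (intro ln_le_minus_one) auto
  then have "(l - v) / l \<le> ln (l / v)" using assms by (simp add: ln_div diff_divide_distrib)
  then have "\<beta> * ((l - v) / l) \<le> \<beta> * ln (l / v)" using assms by (intro mult_left_mono) auto
  then have "1 + \<beta> * (l - v) / l \<le> 1 + \<beta> * ln (l / v)" by simp
  also have "\<dots> \<le> exp (\<beta> * ln (l / v))" by (rule exp_ge_add_one_self)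
  also have "\<dots> = (l / v) powr \<beta>" using assms by (simp add: powr_def)
  finally show ?thesis .
qed

lemma exp_tilt_bound:
  fixes c \<beta> q :: real
  assumes c: "0 < c" and \<beta>: "0 < \<beta>" and q: "0 \<le> q"
  shows "\<forall>\<^sub>F x in at_top. \<forall>u s. s \<le> c / ln x powr \<beta> * (1 + \<beta> * ln 2 / 2 / ln x) \<longrightarrow>
    ln x powr \<beta> / (2 * c) \<le> u \<longrightarrow> u \<le> x / 2 \<longrightarrow>
    q * ln u + s * u - hazard c \<beta> u \<le> - 2 * \<beta> * ln (ln x)"
proof -
  define \<eta> where "\<eta> = \<beta> * ln 2 / 2"
  have \<eta>: "\<eta> > 0" using \<beta> by (simp add: \<eta>_def)
  \<comment> \<open>In the variables \<open>l = ln x\<close>, \<open>v = ln u\<close>, the gap is \<open>(c u / L) ((l / v) powr \<beta> - 1 - \<eta> / l)\<close>.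
    For \<open>v \<ge> (\<beta> + 3) ln l\<close> the factor \<open>u\<close> dominates everything; for smaller \<open>v\<close> the ratio \<open>l / v\<close> is
    large, and the lower limit \<open>L / (2 c)\<close> of \<open>u\<close> suffices.\<close>
  have "\<forall>\<^sub>F l in at_top. q * l - c * \<eta> * l\<^sup>2 \<le> - 2 * \<beta> * ln l"
    using c \<eta> \<beta> by real_asymp
  moreover have "\<forall>\<^sub>F l in at_top. (l / ((\<beta> + 3) * ln l)) powr \<beta> \<ge> 2 * (1 + \<eta>)"
    using \<beta> by real_asymp
  moreover have "\<forall>\<^sub>F l in at_top. q * ((\<beta> + 3) * ln l) - l powr \<beta> * ((\<beta> + 3) * ln l) powr (-\<beta>) / 4 \<le> - 2 * \<beta> * ln l"
    using \<beta> q by real_asymp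
  moreover have "\<forall>\<^sub>F l in at_top. l powr \<beta> / (2 * c) \<ge> exp 1"
    using \<beta> c by real_asymp
  moreover have "\<forall>\<^sub>F l in at_top. l > (1::real)" by real_asymp
  ultimately have "\<forall>\<^sub>F l in at_top. \<forall>v s. s \<le> c / l powr \<beta> * (1 + \<eta> / l) \<longrightarrow>
    l powr \<beta> / (2 * c) \<le> exp v \<longrightarrow> v \<le> l - ln 2 \<longrightarrow>
    q * v + s * exp v - c * exp v * v powr (-\<beta>) \<le> - 2 * \<beta> * ln l"
  proof eventually_elim
    case (elim l)
    show ?case
    proof (intro allI impI)
      fix v s assume s: "s \<le> c / l powr \<beta> * (1 + \<eta> / l)" and v: "l powr \<beta> / (2 * c) \<le> exp v" "v \<le> l - ln 2"
      define L where "L = l powr \<beta>"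
      have l: "l > 1" by fact
      have L: "L > 0" using l by (simp add: L_def)
      have v1: "v \<ge> 1" using v elim by (metis exp_le_cancel_iff order_trans)
      define r where "r = (l / v) powr \<beta>"
      have r: "v powr (-\<beta>) = r / L"
        using l v1 by (simp add: r_def L_def powr_divide powr_minus_divide)
      have "s * exp v \<le> c / L * (1 + \<eta> / l) * exp v"
        using s by (intro mult_right_mono) (auto simp: L_def)
      then have main: "s * exp v - c * exp v * v powr (-\<beta>) \<le> - (c * exp v / L) * (r - 1 - \<eta> / l)"
        unfolding r using L l by (simp add: field_simps)
      show "q * v + s * exp v - c * exp v * v powr (-\<beta>) \<le> - 2 * \<beta> * ln l"
      proof (cases "v \<ge> (\<beta> + 3) * ln l")
        case True
        have "\<eta> / l = \<beta> * ln 2 / l - \<eta> / l" using l by (simp add: \<eta>_def field_simps)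
        also have "\<dots> \<le> \<beta> * (l - v) / l - \<eta> / l"
          using l v \<beta> by (intro diff_right_mono divide_right_mono mult_left_mono) auto
        also have "\<dots> \<le> r - 1 - \<eta> / l"
          using powr_ge_one_plus[of v l \<beta>] v1 l \<beta> by (simp add: r_def)
        finally have "\<eta> / l \<le> r - 1 - \<eta> / l" .
        then have A: "(c * exp v / L) * (\<eta> / l) \<le> (c * exp v / L) * (r - 1 - \<eta> / l)"
          using c L by (intro mult_left_mono) auto
        have "l\<^sup>2 * L * l = exp ((\<beta> + 3) * ln l)"
          using l by (simp add: L_def powr_def exp_add distrib_right exp_of_nat_mult[of 3 "ln l", simplified] power3_eq_cube power2_eq_square)
        \<comment> \<open>This fixes the threshold (\<beta> + 3) ln l: \<beta> pays for L, one unit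
          for the gap \<eta> / l, and the remaining l^2 beats q l + 2 \<beta> ln l.\<close>
        also have "\<dots> \<le> exp v" using True by simp
        finally have "c * \<eta> * l\<^sup>2 \<le> (c * exp v / L) * (\<eta> / l)"
          using c \<eta> l L by (simp add: field_simps)
        moreover have "q * v \<le> q * l" using q v l by (intro mult_left_mono) (auto intro: order_trans)
        ultimately show ?thesis using main A elim(1) by linarith
      next
        case False
        have "2 * (1 + \<eta>) \<le> (l / ((\<beta> + 3) * ln l)) powr \<beta>" by fact
        also have "\<dots> \<le> r" unfolding r_def
          using False l v1 \<beta> by (intro powr_mono2 divide_left_mono) auto
        finally have "r \<ge> 2 * (1 + \<eta>)" .
        moreover have "\<eta> / l \<le> \<eta>" using l \<eta> by (simp add: field_simps)
        ultimately have "r / 2 \<le> r - 1 - \<eta> / l" by simp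
        then have A: "(c * exp v / L) * (r / 2) \<le> (c * exp v / L) * (r - 1 - \<eta> / l)"
          using c L by (intro mult_left_mono) auto
        have "((\<beta> + 3) * ln l) powr (-\<beta>) \<le> v powr (-\<beta>)"
          using False l v1 \<beta> by (intro powr_mono2') auto
        then have "(L / (2 * c)) * (c / 2) * ((\<beta> + 3) * ln l) powr (-\<beta>) \<le> exp v * (c / 2) * v powr (-\<beta>)"
          using v c L by (intro mult_mono) (auto simp: L_def)
        also have "\<dots> = (c * exp v / L) * (r / 2)" unfolding r by (simp add: mult_ac)
        finally have "L * ((\<beta> + 3) * ln l) powr (-\<beta>) / 4 \<le> (c * exp v / L) * (r / 2)"
          using c by simp
        moreover have "q * v \<le> q * ((\<beta> + 3) * ln l)" using q False by (intro mult_left_mono) auto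
        ultimately show ?thesis using main A elim(3) unfolding L_def by linarith
      qed
    qed
  qed
  then have "\<forall>\<^sub>F x in at_top. \<forall>v s. s \<le> c / ln x powr \<beta> * (1 + \<eta> / ln x) \<longrightarrow>
    ln x powr \<beta> / (2 * c) \<le> exp v \<longrightarrow> v \<le> ln x - ln 2 \<longrightarrow>
    q * v + s * exp v - c * exp v * v powr (-\<beta>) \<le> - 2 * \<beta> * ln (ln x)"
    by (rule filterlim_iff[THEN iffD1, OF ln_at_top, rule_format])
  moreover have "\<forall>\<^sub>F x in at_top. x > (1::real)" by real_asymp
  ultimately show ?thesis
  proof eventually_elim
    case (elim x)
    show ?case
    proof (intro allI impI)
      fix u s assume s: "s \<le> c / ln x powr \<beta> * (1 + \<beta> * ln 2 / 2 / ln x)"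
        and u: "ln x powr \<beta> / (2 * c) \<le> u" "u \<le> x / 2"
      have "0 < ln x powr \<beta> / (2 * c)" using elim c by simp
      then have u0: "u > 0" using u by linarith
      have "ln u \<le> ln (x / 2)" using u u0 elim by (subst ln_le_cancel_iff) auto
      then have "ln u \<le> ln x - ln 2" using elim by (simp add: ln_div)
      then show "q * ln u + s * u - hazard c \<beta> u \<le> - 2 * \<beta> * ln (ln x)"
        using elim(1)[rule_format, of s "ln u"] s u u0 by (simp add: \<eta>_def hazard_def)
    qed
  qed
qed

section \<open>The distribution of a summand\<close>

lemma mem_shifted_Delta: "z \<in> shifted_Delta T x \<longleftrightarrow> x < z \<and> ereal (z - x) \<le> T"
proof
  assume "x < z \<and> ereal (z - x) \<le> T"
  then show "z \<in> shifted_Delta T x"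
    unfolding shifted_Delta_def Delta_def by (intro image_eqI[of _ _ "z - x"]) auto
qed (auto simp: shifted_Delta_def Delta_def)

lemma shifted_Delta_measurable [measurable]: "shifted_Delta T x \<in> sets borel"
proof -
  have "shifted_Delta T x = {z. x < z \<and> ereal (z - x) \<le> T}"
    by (auto simp: mem_shifted_Delta)
  then show ?thesis by simp
qed

locale semiexponential =
  fixes F :: "real measure" and T :: ereal and p :: "real \<Rightarrow> real" and c \<beta> :: real
  assumes prob_F: "prob_space F" and sets_F [measurable_cong, simp]: "sets F = sets borel"
    and T: "0 < T"
    and int1: "integrable F (\<lambda>t. t)" and mean: "(LINT t|F. t) = 0"
    and int2: "integrable F (\<lambda>t. t\<^sup>2)" and var: "(LINT t|F. t\<^sup>2) = 1"
    and \<beta>: "0 < \<beta>" and c: "0 < c"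
    and irv: "intermediate_regularly_varying p"
    and asym: "\<forall>\<^sub>F x in at_top. measure F (shifted_Delta T x) = p x * exp (- c * x * ln x powr (- \<beta>))"
begin

sublocale F: prob_space F by (rule prob_F)

text \<open>For finite \<open>T\<close> this is a local probability, not a tail;
  \<open>G_forward_bound\<close> stands in for monotonicity.\<close>

definition G :: "real \<Rightarrow> real" where "G x = measure F (shifted_Delta T x)"

lemma G_eq: "\<forall>\<^sub>F x in at_top. 0 < p x \<and> G x = p x * exp (- hazard c \<beta> x)"
proof -
  have "\<forall>\<^sub>F x in at_top. 0 < p x"
    using irv unfolding intermediate_regularly_varying_def positive_measurable_near_infinity_def eventually_at_top_linorder
    by auto
  with asym show ?thesis
    by eventually_elim (simp add: G_def hazard_def)
qed

lemma G_pos: "\<forall>\<^sub>F x in at_top. 0 < G x"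
  using G_eq by eventually_elim simp

lemma hazard_mono: "\<exists>Y>1. \<forall>u\<ge>Y. \<forall>v\<ge>u. hazard c \<beta> u \<le> hazard c \<beta> v"
  using hazard_minus_ln_mono[OF c \<beta>, of 0] by simp

section \<open>Comparison of the tail at different points\<close>

text \<open>The Potter power (y/x)^a is swallowed by the eventual monotonicity of h - a ln. This
  covers a strongly negative sum of the other summands.\<close>

lemma G_forward_bound: "\<exists>K>0. \<exists>X. \<forall>x\<ge>X. \<forall>y\<ge>x. G y \<le> K * G x"
proof -
  obtain K a X1 where K: "1 \<le> K" and P: "\<And>x y. X1 \<le> x \<Longrightarrow> x \<le> y \<Longrightarrow> p y \<le> K * (y / x) powr a * p x"
    using irv_potter[OF irv] by metis
  obtain Y where Y: "1 < Y" and mono: "\<And>u v. Y \<le> u \<Longrightarrow> u \<le> v \<Longrightarrow> hazard c \<beta> u - a * ln u \<le> hazard c \<beta> v - a * ln v"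
    using hazard_minus_ln_mono[OF c \<beta>, of a] by metis
  obtain X2 where G: "\<And>x. X2 \<le> x \<Longrightarrow> 0 < p x \<and> G x = p x * exp (- hazard c \<beta> x)"
    using G_eq unfolding eventually_at_top_linorder by auto
  have "G y \<le> K * G x" if x: "max X1 (max X2 Y) \<le> x" and y: "x \<le> y" for x y
  proof -
    have "G y = p y * exp (- hazard c \<beta> y)" using G x y by auto
    also have "\<dots> \<le> (K * (y / x) powr a * p x) * exp (- hazard c \<beta> x - a * ln y + a * ln x)"
      using P[of x y] mono[of x y] G[of x] K x y by (intro mult_mono) (auto intro!: mult_nonneg_nonneg)
    also have "exp (- hazard c \<beta> x - a * ln y + a * ln x) = exp (- hazard c \<beta> x) / (y / x) powr a"
      using x y Y by (simp add: powr_def ln_div right_diff_distrib exp_diff exp_add exp_minus field_simps)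
    also have "(K * (y / x) powr a * p x) * (exp (- hazard c \<beta> x) / (y / x) powr a) = K * G x"
      using G[of x] x y Y by simp
    finally show ?thesis .
  qed
  then show ?thesis using K by (intro exI[of _ K] conjI exI[of _ "max X1 (max X2 Y)"]) auto
qed

text \<open>For y \<le> x/2 the Potter ratio x/(x - y) is at most 2, so p costs a constant and
  \<open>hazard_diff_le\<close> gives the exponential.\<close>

lemma G_backward_bound:
  "\<exists>K>0. \<exists>X. \<forall>x\<ge>X. \<forall>y\<in>{0..x / 2}. G (x - y) \<le> K * exp (c * y / ln x powr \<beta>) * G x"
proof -
  obtain K a X1 where K: "1 \<le> K" and a: "0 \<le> a"
    and P: "\<And>x y. X1 \<le> x \<Longrightarrow> x \<le> y \<Longrightarrow> p x \<le> K * (y / x) powr a * p y"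
    using irv_potter[OF irv] by metis
  obtain X2 where G: "\<And>x. X2 \<le> x \<Longrightarrow> 0 < p x \<and> G x = p x * exp (- hazard c \<beta> x)"
    using G_eq unfolding eventually_at_top_linorder by auto
  have "G (x - y) \<le> (K * 2 powr a) * exp (c * y / ln x powr \<beta>) * G x"
    if x: "max (2 * X1) (max (2 * X2) 3) \<le> x" and y: "y \<in> {0..x / 2}" for x y
  proof -
    have z: "X1 \<le> x - y" "X2 \<le> x - y" "x - y \<le> x" "1 < x - y" "0 \<le> y" "X2 \<le> x" using x y by auto
    have "p (x - y) \<le> K * (x / (x - y)) powr a * p x" using P z by auto
    also have "\<dots> \<le> K * 2 powr a * p x"
      using K a y x G[of x] z by (intro mult_right_mono mult_left_mono powr_mono2) (auto simp: field_simps)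
    finally have "p (x - y) \<le> K * 2 powr a * p x" .
    moreover have "exp (- hazard c \<beta> (x - y)) \<le> exp (c * y / ln x powr \<beta> - hazard c \<beta> x)"
      using hazard_diff_le[OF c \<beta> z(5,4)] by simp
    ultimately have "p (x - y) * exp (- hazard c \<beta> (x - y)) \<le> (K * 2 powr a * p x) * exp (c * y / ln x powr \<beta> - hazard c \<beta> x)"
      using G[of x] z K by (intro mult_mono) auto
    also have "\<dots> = K * 2 powr a * exp (c * y / ln x powr \<beta>) * (p x * exp (- hazard c \<beta> x))"
      by (simp only: diff_conv_add_uminus exp_add mult_ac)
    finally show ?thesis using G[of x] G[of "x - y"] z by simp
  qed
  then show ?thesis
    using K by (intro exI[of _ "K * 2 powr a"] conjI exI[of _ "max (2 * X1) (max (2 * X2) 3)"]) auto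
qed

text \<open>The budget \<epsilon> is split in halves: \<delta> = \<epsilon>/(2c) bounds the change
  of h by \<epsilon>/2, and since L = o(x) the relative shift tends to 0, so ln p also changes by at
  most \<epsilon>/2.\<close>

lemma G_insensitive:
  assumes \<epsilon>: "0 < \<epsilon>"
  shows "\<exists>\<delta>>0. \<forall>\<^sub>F x in at_top. \<forall>y. \<bar>y\<bar> \<le> \<delta> * ln x powr \<beta> \<longrightarrow>
    G (x - y) \<le> exp \<epsilon> * G x \<and> G x \<le> exp \<epsilon> * G (x - y)"
proof -
  obtain \<delta>1 X1 where \<delta>1: "0 < \<delta>1" and U: "\<And>x y. X1 \<le> x \<Longrightarrow> y \<in> {x..(1 + \<delta>1) * x} \<Longrightarrow>
      p y \<le> exp (\<epsilon> / 2) * p x \<and> p x \<le> exp (\<epsilon> / 2) * p y"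
    using irv_uniform[OF irv, of "\<epsilon> / 2"] \<epsilon> by (metis half_gt_zero)
  obtain X2 where G: "\<And>x. X2 \<le> x \<Longrightarrow> 0 < p x \<and> G x = p x * exp (- hazard c \<beta> x)"
    using G_eq unfolding eventually_at_top_linorder by auto
  obtain Y where Y: "1 < Y" and mono: "\<And>u v. Y \<le> u \<Longrightarrow> u \<le> v \<Longrightarrow> hazard c \<beta> u \<le> hazard c \<beta> v"
    using hazard_mono by metis
  define Z where "Z = max X1 (max X2 (max Y 2))"
  define \<delta> where "\<delta> = \<epsilon> / (2 * c)"
  \<comment> \<open>Stated for an ordered pair so that both signs of y reduce to it; for negative y
    the larger point is x - y.\<close>
  have step: "G z \<le> exp \<epsilon> * G x \<and> G x \<le> exp \<epsilon> * G z"
    if "Z \<le> z" "z \<le> x" "x \<le> (1 + \<delta>1) * z" "x - z \<le> \<delta> * ln x powr \<beta>" for x z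
  proof -
    have h1: "hazard c \<beta> z \<le> hazard c \<beta> x" using mono that by (simp add: Z_def)
    have "hazard c \<beta> x - hazard c \<beta> (x - (x - z)) \<le> c * (x - z) / ln x powr \<beta>"
      using that by (intro hazard_diff_le c \<beta>) (auto simp: Z_def)
    also have "\<dots> \<le> c * (\<delta> * ln x powr \<beta>) / ln x powr \<beta>"
      using that c by (intro divide_right_mono mult_left_mono) auto
    also have "\<dots> = \<epsilon> / 2" using c that by (simp add: \<delta>_def Z_def)
    finally have h2: "hazard c \<beta> x - \<epsilon> / 2 \<le> hazard c \<beta> z" by simp
    have pq: "p x \<le> exp (\<epsilon> / 2) * p z" "p z \<le> exp (\<epsilon> / 2) * p x"
      using U[of z x] that by (auto simp: Z_def)
    have pos: "0 < p x" "0 < p z" and Gx: "G x = p x * exp (- hazard c \<beta> x)" and Gz: "G z = p z * exp (- hazard c \<beta> z)"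
      using G[of x] G[of z] that by (auto simp: Z_def)
    have "G z \<le> (exp (\<epsilon> / 2) * p x) * exp (\<epsilon> / 2 - hazard c \<beta> x)"
      unfolding Gz using pq pos h2 by (intro mult_mono) auto
    also have "\<dots> = exp (\<epsilon> / 2 + \<epsilon> / 2) * G x"
      unfolding Gx exp_diff exp_add exp_minus by (simp add: field_simps)
    finally have 1: "G z \<le> exp \<epsilon> * G x" by simp
    have "G x \<le> (exp (\<epsilon> / 2) * p z) * exp (\<epsilon> / 2 - hazard c \<beta> z)"
      unfolding Gx using pq pos h1 \<epsilon> by (intro mult_mono) auto
    also have "\<dots> = exp (\<epsilon> / 2 + \<epsilon> / 2) * G z"
      unfolding Gz exp_diff exp_add exp_minus by (simp add: field_simps)
    finally have 2: "G x \<le> exp \<epsilon> * G z" by simp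
    show ?thesis using 1 2 by simp
  qed
  have \<delta>: "0 < \<delta>" using \<epsilon> c by (simp add: \<delta>_def)
  have "\<forall>\<^sub>F x in at_top. \<delta> * ln x powr \<beta> \<le> min 1 \<delta>1 / 2 * x"
    using \<delta> \<beta> \<delta>1 by real_asymp
  moreover have "\<forall>\<^sub>F x in at_top. x \<ge> 2 * Z" by (rule eventually_ge_at_top)
  ultimately have "\<forall>\<^sub>F x in at_top. \<forall>y. \<bar>y\<bar> \<le> \<delta> * ln x powr \<beta> \<longrightarrow>
    G (x - y) \<le> exp \<epsilon> * G x \<and> G x \<le> exp \<epsilon> * G (x - y)"
  proof eventually_elim
    case (elim x)
    show ?case
    proof (intro allI impI)
      fix y assume y: "\<bar>y\<bar> \<le> \<delta> * ln x powr \<beta>"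
      have x: "2 < x" using elim by (simp add: Z_def)
      \<comment> \<open>The first bound keeps the ratio of the two points within 1 +
        \<open>\<delta>1\<close>; the second keeps x - y above x/2 and hence above
        \<open>Z\<close>.\<close>
      have y': "\<bar>y\<bar> \<le> \<delta>1 * (x / 2)" "\<bar>y\<bar> \<le> x / 2"
        using y elim(1) x mult_right_mono[OF min.cobounded2[of 1 \<delta>1], of x]
          mult_right_mono[OF min.cobounded1[of 1 \<delta>1], of x] by linarith+
      show "G (x - y) \<le> exp \<epsilon> * G x \<and> G x \<le> exp \<epsilon> * G (x - y)"
      proof (cases "0 \<le> y")
        case True
        have "\<delta>1 * (x / 2) \<le> \<delta>1 * (x - y)" using y' \<delta>1 by (intro mult_left_mono) auto
        then have "x \<le> (1 + \<delta>1) * (x - y)" using y' True by (simp add: algebra_simps)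
        then show ?thesis using step[of "x - y" x] y y' elim True by auto
      next
        case False
        have "\<delta>1 * (x / 2) \<le> \<delta>1 * x" using x \<delta>1 by (intro mult_left_mono) auto
        then have "x - y \<le> (1 + \<delta>1) * x" using y' False by (simp add: algebra_simps)
        moreover have "ln x powr \<beta> \<le> ln (x - y) powr \<beta>"
          using False x \<beta> by (intro powr_mono2) auto
        then have "\<delta> * ln x powr \<beta> \<le> \<delta> * ln (x - y) powr \<beta>" using \<delta> by (intro mult_left_mono) auto
        moreover have "2 \<le> Z" by (simp add: Z_def)
        then have "Z \<le> x" using elim by linarith
        ultimately show ?thesis using step[of x "x - y"] y False by auto
      qed
    qed
  qed
  then show ?thesis using \<delta> by blast
qed

text \<open>The main exponents cancel, leaving exp(-c \<eta> x / (L ln x)) / p x, and 1 / p x grows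
  at most like a power. With \<eta> = 0 only 1 / p x would remain, which need not tend to 0.\<close>

lemma exponential_negligible:
  assumes \<eta>: "0 < \<eta>"
  shows "((\<lambda>x. exp (- (c / ln x powr \<beta> * (1 + \<eta> / ln x)) * x) / G x) \<longlongrightarrow> 0) at_top"
proof -
  obtain K a X where K: "1 \<le> K" and X: "1 \<le> X" and pX: "0 < p X"
    and P: "\<And>y. X \<le> y \<Longrightarrow> p X \<le> K * (y / X) powr a * p y"
    using irv_potter[OF irv] by (metis order_refl)
  have "((\<lambda>x. K / p X * (x / X) powr a * exp (- (c * \<eta> * x / (ln x powr \<beta> * ln x)))) \<longlongrightarrow> 0) at_top"
    using K X pX c \<eta> \<beta> by real_asymp
  moreover have "\<forall>\<^sub>F x in at_top. norm (exp (- (c / ln x powr \<beta> * (1 + \<eta> / ln x)) * x) / G x)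
      \<le> K / p X * (x / X) powr a * exp (- (c * \<eta> * x / (ln x powr \<beta> * ln x)))"
    using G_eq eventually_ge_at_top[of "X + 2"]
  proof eventually_elim
    case (elim x)
    have "exp u / G x = (1 / p x) * exp (u + hazard c \<beta> x)" for u
      unfolding conjunct2[OF elim(1)] using elim(1) by (simp add: exp_add exp_minus divide_simps)
    then have "exp (- (c / ln x powr \<beta> * (1 + \<eta> / ln x)) * x) / G x =
       (1 / p x) * exp (- (c / ln x powr \<beta> * (1 + \<eta> / ln x)) * x + hazard c \<beta> x)" .
    also have "- (c / ln x powr \<beta> * (1 + \<eta> / ln x)) * x + hazard c \<beta> x = - (c * \<eta> * x / (ln x powr \<beta> * ln x))"
      using elim X by (simp add: hazard_def powr_minus field_simps)
    also have "1 / p x \<le> K / p X * (x / X) powr a"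
      using P[of x] pX elim by (simp add: field_simps)
    finally show ?case using elim by (simp add: mult_right_mono)
  qed
  ultimately show ?thesis by (rule Lim_null_comparison[rotated])
qed

section \<open>Exponential moments of a truncated summand\<close>

text \<open>On a short cell exp(h) varies by a bounded factor and cancels against the cell mass, so
  the cell at z contributes a multiple of p z / z^q, which is summable for large q. The weight is
  packaged with its monotonicity, which a Markov inequality at x/2 needs later.\<close>

lemma weighted_moment_finite:
  "\<exists>q Y. 0 \<le> q \<and> 1 < Y \<and>
    (\<forall>u\<ge>Y. \<forall>v\<ge>u. hazard c \<beta> u - q * ln u \<le> hazard c \<beta> v - q * ln v) \<and>
    (\<integral>\<^sup>+t. ennreal (exp (hazard c \<beta> t - q * ln t)) * indicator {Y<..} t \<partial>F) < \<infinity>"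
proof -
  obtain K a X1 where K: "1 \<le> K" and a: "0 \<le> a" and X1: "1 \<le> X1" and pX: "\<And>x. X1 \<le> x \<Longrightarrow> 0 < p x"
    and P: "\<And>x y. X1 \<le> x \<Longrightarrow> x \<le> y \<Longrightarrow> p y \<le> K * (y / x) powr a * p x"
    using irv_potter[OF irv] by metis
  \<comment> \<open>The a cancels the Potter growth of p; the 2 leaves a convergent sum of inverse
    squares.\<close>
  define q where "q = a + 2"
  obtain Y1 where Y1: "1 < Y1" and mono: "\<And>u v. Y1 \<le> u \<Longrightarrow> u \<le> v \<Longrightarrow> hazard c \<beta> u - q * ln u \<le> hazard c \<beta> v - q * ln v"
    using hazard_minus_ln_mono[OF c \<beta>, of q] by metis
  obtain X2 where G: "\<And>x. X2 \<le> x \<Longrightarrow> 0 < p x \<and> G x = p x * exp (- hazard c \<beta> x)"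
    using G_eq unfolding eventually_at_top_linorder by auto
  define Y where "Y = max X1 (max X2 (max Y1 3))"
  \<comment> \<open>Cut the half-line into cells of length \<open>\<tau> \<le> T\<close>, each of mass at most \<open>G\<close> of its left end.\<close>
  obtain \<tau> :: real where \<tau>: "0 < \<tau>" "\<tau> \<le> 1" "ereal \<tau> \<le> T"
  proof (cases "T \<ge> 1")
    case True
    then show ?thesis using that[of 1] by (simp add: one_ereal_def)
  next
    case False
    with T obtain r where "T = ereal r" "0 < r" "r \<le> 1" by (cases T) auto
    then show ?thesis using that[of r] by simp
  qed
  define z where "z k = Y + real k * \<tau>" for k
  define w where "w t = exp (hazard c \<beta> t - q * ln t)" for t
  have [measurable]: "w \<in> borel_measurable borel" unfolding w_def hazard_def by measurable
  have Y3: "3 \<le> Y" by (simp add: Y_def)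
  have pY: "0 < p Y" by (rule pX) (simp add: Y_def)
  have zY: "Y \<le> z k" for k using \<tau> by (simp add: z_def)
  have zS: "z (Suc k) = z k + \<tau>" for k by (simp add: z_def algebra_simps)
  define C where "C = exp c * K * p Y"
  have C: "0 \<le> C" using K pX[of Y] by (simp add: C_def Y_def)
  have cell: "emeasure (density F w) {z k<..z (Suc k)} \<le> ennreal (C / \<tau>\<^sup>2 * inverse ((real (Suc k))\<^sup>2))" for k
  proof -
    let ?z = "z k"
    have z: "3 \<le> ?z" "X2 \<le> ?z" "Y1 \<le> ?z" using zY[of k] by (auto simp: Y_def)
    \<comment> \<open>Since Y \<ge> \<tau>, the offset Y is worth one more cell; this yields the
      index \<open>Suc k\<close> and avoids division by zero at k = 0.\<close>
    have "(?z) \<ge> \<tau> * real (Suc k)" using \<tau> zY[of k] by (simp add: z_def Y_def algebra_simps)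
    then have zsq: "?z\<^sup>2 \<ge> (\<tau> * real (Suc k))\<^sup>2" using \<tau> by (intro power_mono) auto
    have wz: "w t \<le> exp (hazard c \<beta> ?z + c) / ?z powr q" if t: "t \<in> {?z<..z (Suc k)}" for t
    proof -
      \<comment> \<open>Across one cell h grows by at most c: the length is at most 1, and z \<ge> 3
        > e makes the logarithm at least 1.\<close>
      have "hazard c \<beta> t - hazard c \<beta> (t - (t - ?z)) \<le> c * (t - ?z) / ln t powr \<beta>"
        using t z by (intro hazard_diff_le c \<beta>) auto
      also have "\<dots> \<le> c * 1 / 1"
      proof -
        have "exp 1 \<le> t" using exp_le z t by simp
        then have "1 \<le> ln t" using t z by (simp add: ln_ge_iff)
        then have "1 \<le> ln t powr \<beta>" using \<beta> by (simp add: ge_one_powr_ge_zero)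
        then show ?thesis using c t z \<tau> zS[of k] by (intro frac_le mult_left_mono) auto
      qed
      finally have "hazard c \<beta> t \<le> hazard c \<beta> ?z + c" by simp
      moreover have "q * ln ?z \<le> q * ln t" using t z a by (intro mult_left_mono) (auto simp: q_def)
      ultimately have "w t \<le> exp (hazard c \<beta> ?z + c - q * ln ?z)" by (simp add: w_def)
      also have "\<dots> = exp (hazard c \<beta> ?z + c) / ?z powr q" using z by (simp add: powr_def exp_diff)
      finally show ?thesis .
    qed
    have "emeasure (density F w) {?z<..z (Suc k)} = (\<integral>\<^sup>+t. ennreal (w t) * indicator {?z<..z (Suc k)} t \<partial>F)"
      by (rule emeasure_density) auto
    also have "\<dots> \<le> (\<integral>\<^sup>+t. ennreal (exp (hazard c \<beta> ?z + c) / ?z powr q) * indicator {?z<..z (Suc k)} t \<partial>F)"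
      using wz by (intro nn_integral_mono) (auto split: split_indicator intro: ennreal_leI)
    also have "\<dots> = ennreal (exp (hazard c \<beta> ?z + c) / ?z powr q) * ennreal (measure F {?z<..z (Suc k)})"
      by (simp add: nn_integral_cmult_indicator F.emeasure_eq_measure)
    also have "\<dots> \<le> ennreal (exp (hazard c \<beta> ?z + c) / ?z powr q) * ennreal (G ?z)"
    proof (intro mult_left_mono ennreal_leI)
      have "ereal (t - ?z) \<le> T" if "t \<le> z (Suc k)" for t
        using \<tau>(3) that by (intro order_trans[OF _ \<tau>(3)]) (simp add: zS)
      then show "measure F {?z<..z (Suc k)} \<le> G ?z"
        unfolding G_def by (intro F.finite_measure_mono) (auto simp: mem_shifted_Delta)
    qed simp
    also have "\<dots> = ennreal (exp c * p ?z / ?z powr q)"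
    proof -
      have "exp (hazard c \<beta> ?z + c) / ?z powr q * G ?z = exp c * p ?z / ?z powr q"
        using G[of ?z] z by (simp add: exp_add exp_minus field_simps)
      moreover have "ennreal (exp (hazard c \<beta> ?z + c) / ?z powr q) * ennreal (G ?z) =
          ennreal (exp (hazard c \<beta> ?z + c) / ?z powr q * G ?z)"
        by (rule ennreal_mult[symmetric]) (auto simp: G_def)
      ultimately show ?thesis by (simp only:)
    qed
    also have "\<dots> \<le> ennreal (C / \<tau>\<^sup>2 * inverse ((real (Suc k))\<^sup>2))"
    proof (rule ennreal_leI)
      have "p ?z \<le> K * (?z / Y) powr a * p Y" using zY[of k] by (intro P) (auto simp: Y_def)
      also have "\<dots> \<le> K * ?z powr a * p Y"
      proof (intro mult_right_mono mult_left_mono powr_mono2)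
        show "?z / Y \<le> ?z" using z Y3 divide_left_mono[of 1 Y ?z] by simp
      qed (use K a pY z Y3 in simp_all)
      finally have "exp c * p ?z / ?z powr q \<le> exp c * (K * ?z powr a * p Y) / ?z powr q"
        using z by (intro divide_right_mono mult_left_mono) auto
      also have "\<dots> = C / ?z\<^sup>2" using z by (simp add: C_def q_def powr_add field_simps)
      also have "\<dots> \<le> C / (\<tau> * real (Suc k))\<^sup>2"
        using C \<tau> z zsq by (intro divide_left_mono) auto
      also have "\<dots> = C / \<tau>\<^sup>2 * inverse ((real (Suc k))\<^sup>2)" by (simp only: power_mult_distrib divide_inverse inverse_mult_distrib mult_ac)
      finally show "exp c * p ?z / ?z powr q \<le> \<dots>" .
    qed
    finally show ?thesis .
  qed
  have cover: "{Y<..} \<subseteq> (\<Union>k. {z k<..z (Suc k)})"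
  proof
    fix t assume t: "t \<in> {Y<..}"
    \<comment> \<open>Ceiling minus one rather than floor, as the cells are open on the left and
      closed on the right.\<close>
    define k where "k = nat (\<lceil>(t - Y) / \<tau>\<rceil> - 1)"
    have "0 < (t - Y) / \<tau>" using t \<tau> by simp
    then have "real k < (t - Y) / \<tau>" "(t - Y) / \<tau> \<le> real k + 1"
      by (auto simp: k_def) linarith+
    then have "z k < t" "t \<le> z (Suc k)" using \<tau> by (auto simp: z_def field_simps)
    then show "t \<in> (\<Union>k. {z k<..z (Suc k)})" by auto
  qed
  have "(\<integral>\<^sup>+t. ennreal (w t) * indicator {Y<..} t \<partial>F) = emeasure (density F w) {Y<..}"
    by (rule emeasure_density[symmetric]) auto
  also have "\<dots> \<le> emeasure (density F w) (\<Union>k. {z k<..z (Suc k)})"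
    by (rule emeasure_mono[OF cover]) auto
  also have "\<dots> \<le> (\<Sum>k. emeasure (density F w) {z k<..z (Suc k)})"
    by (rule emeasure_subadditive_countably) auto
  also have "\<dots> \<le> (\<Sum>k. ennreal (C / \<tau>\<^sup>2 * inverse ((real (Suc k))\<^sup>2)))"
    by (intro suminf_le cell) auto
  also have "\<dots> = ennreal (\<Sum>k. C / \<tau>\<^sup>2 * inverse ((real (Suc k))\<^sup>2))"
  proof (rule suminf_ennreal_eq[OF _ summable_sums])
    have "summable (\<lambda>k. inverse ((real k)\<^sup>2))" using inverse_power_summable[of 2, where ?'a = real] by simp
    then have "summable (\<lambda>k. inverse ((real (Suc k))\<^sup>2))" by (subst summable_Suc_iff)
    then show "summable (\<lambda>k. C / \<tau>\<^sup>2 * inverse ((real (Suc k))\<^sup>2))" by (rule summable_mult)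
  qed (use C in auto)
  also have "\<dots> < \<infinity>" by simp
  finally have "(\<integral>\<^sup>+t. ennreal (w t) * indicator {Y<..} t \<partial>F) < \<infinity>" .
  then show ?thesis
    using mono Y1 a unfolding w_def
    by (intro exI[of _ q] exI[of _ Y] conjI) (auto simp: q_def Y_def)
qed

text \<open>Up to 1/s the expansion exp z \<le> 1 + z + z^2 with mean 0 and variance 1 gives 1 +
  s^2, where s \<le> 2c/L yields the part 4 c^2 of the constant. From 1/s to x/2 the integrand is at
  most w/L^2 by \<open>exp_tilt_bound\<close>, and the finite weighted moment is the other part. The
  second estimate controls a further big jump among the remaining summands.\<close>

lemma tilted_bounds:
  "\<exists>C>0. \<forall>\<^sub>F x in at_top. \<forall>s. c / ln x powr \<beta> \<le> s \<longrightarrow>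
      s \<le> c / ln x powr \<beta> * (1 + \<beta> * ln 2 / 2 / ln x) \<longrightarrow>
    (\<integral>\<^sup>+t. ennreal (exp (s * t)) * indicator {..x / 2} t \<partial>F) \<le> ennreal (1 + C / (ln x powr \<beta>)\<^sup>2) \<and>
    exp (c / ln x powr \<beta> * (x / 2)) * measure F {x / 2<..} \<le> C / (ln x powr \<beta>)\<^sup>2"
proof -
  obtain q Y where q: "0 \<le> q" and Y: "1 < Y"
    and mono': "\<forall>u\<ge>Y. \<forall>v\<ge>u. hazard c \<beta> u - q * ln u \<le> hazard c \<beta> v - q * ln v"
    and fin: "(\<integral>\<^sup>+t. ennreal (exp (hazard c \<beta> t - q * ln t)) * indicator {Y<..} t \<partial>F) < \<infinity>"
    using weighted_moment_finite by blast
  have mono: "hazard c \<beta> u - q * ln u \<le> hazard c \<beta> v - q * ln v" if "Y \<le> u" "u \<le> v" for u v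
    using mono' that by blast
  define w where "w t = exp (hazard c \<beta> t - q * ln t)" for t
  have wpos: "0 < w t" for t by (simp add: w_def)
  have wm [measurable]: "w \<in> borel_measurable borel" unfolding w_def hazard_def by measurable
  obtain C0 where C0: "0 \<le> C0" "(\<integral>\<^sup>+t. ennreal (w t) * indicator {Y<..} t \<partial>F) = ennreal C0"
    using fin unfolding w_def by (cases "\<integral>\<^sup>+t. ennreal (exp (hazard c \<beta> t - q * ln t)) * indicator {Y<..} t \<partial>F") auto
  define C where "C = 4 * c\<^sup>2 + C0"
  have "\<forall>\<^sub>F x in at_top. Y \<le> ln x powr \<beta> / (2 * c)" using \<beta> c by real_asymp
  moreover have "\<forall>\<^sub>F x in at_top. ln x powr \<beta> / (2 * c) \<le> x / 2" using \<beta> c by real_asymp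
  moreover have "\<forall>\<^sub>F x in at_top. \<beta> * ln 2 / 2 / ln x \<le> 1" using \<beta> by real_asymp
  moreover have "\<forall>\<^sub>F x in at_top. x > exp (1::real)" by real_asymp
  ultimately have "\<forall>\<^sub>F x in at_top. \<forall>s. c / ln x powr \<beta> \<le> s \<longrightarrow>
      s \<le> c / ln x powr \<beta> * (1 + \<beta> * ln 2 / 2 / ln x) \<longrightarrow>
    (\<integral>\<^sup>+t. ennreal (exp (s * t)) * indicator {..x / 2} t \<partial>F) \<le> ennreal (1 + C / (ln x powr \<beta>)\<^sup>2) \<and>
    exp (c / ln x powr \<beta> * (x / 2)) * measure F {x / 2<..} \<le> C / (ln x powr \<beta>)\<^sup>2"
    using exp_tilt_bound[OF c \<beta> q]
  proof eventually_elim
    case (elim x)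
    define L where "L = ln x powr \<beta>"
    have x1: "1 < x" "1 < ln x"
      using elim(4) exp_ge_add_one_self[of "1::real"] ln_less_cancel_iff[of "exp 1" x] by simp_all
    have L: "L > 0" using x1 by (simp add: L_def)
    have Linv: "exp (- 2 * \<beta> * ln (ln x)) = 1 / L\<^sup>2"
      using x1 by (simp add: L_def powr_def exp_minus divide_inverse mult.assoc exp_of_nat_mult[of 2 "\<beta> * ln (ln x)", simplified])
    show ?case unfolding L_def[symmetric]
    proof (intro allI impI conjI)
      fix s assume s: "c / L \<le> s" "s \<le> c / L * (1 + \<beta> * ln 2 / 2 / ln x)"
      have s0: "0 < s" using s(1) c L by (meson divide_pos_pos less_le_trans)
      have "s \<le> c / L * (1 + 1)"
        using elim(3) c L by (intro order_trans[OF s(2)] mult_left_mono) auto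
      then have s2: "s \<le> 2 * c / L" by (simp add: mult.commute)
      then have invs: "L / (2 * c) \<le> 1 / s" using s0 c L by (simp add: field_simps)
      have pt: "exp (s * u) \<le> w u * (1 / L\<^sup>2)" if u: "L / (2 * c) \<le> u" "u \<le> x / 2" for u
      proof -
        have "q * ln u + s * u - hazard c \<beta> u \<le> - 2 * \<beta> * ln (ln x)"
          using elim(5) s u unfolding L_def by blast
        then have "exp (s * u) \<le> exp (hazard c \<beta> u - q * ln u + - 2 * \<beta> * ln (ln x))" by simp
        also have "\<dots> = w u * (1 / L\<^sup>2)" unfolding exp_add Linv by (simp add: w_def)
        finally show ?thesis .
      qed
      have nn: "0 \<le> 1 + s * t + s\<^sup>2 * t\<^sup>2" for t
      proof -
        have "1 + s * t + s\<^sup>2 * t\<^sup>2 = (1 + s * t / 2)\<^sup>2 + 3 / 4 * (s * t)\<^sup>2" by (simp add: power2_eq_square field_simps)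
        then show ?thesis by simp
      qed
      have "ennreal (exp (s * t)) * indicator {..x / 2} t \<le>
          ennreal (1 + s * t + s\<^sup>2 * t\<^sup>2) + ennreal (1 / L\<^sup>2) * (ennreal (w t) * indicator {Y<..} t)" for t
      \<comment> \<open>Beyond 1/s one has t > 1/s \<ge> L/(2c) \<ge> Y, so both the tilt bound and
        the weighted moment apply there.\<close>
      proof (cases "t \<le> 1 / s")
        case True
        then have "s * t \<le> 1" using s0 by (simp add: field_simps)
        then have "exp (s * t) \<le> 1 + s * t + s\<^sup>2 * t\<^sup>2"
        proof (cases "0 \<le> s * t")
          case True
          then show ?thesis using exp_bound[of "s * t"] \<open>s * t \<le> 1\<close> by (simp add: power_mult_distrib)
        next
          case False
          define v where "v = - (s * t)"
          have v: "0 < v" using False by (simp add: v_def)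
          \<comment> \<open>The product equals 1 + v^3; with 1 + v \<le> exp v this gives the
            quadratic bound for negative arguments of any size.\<close>
          have "1 \<le> (1 - v + v\<^sup>2) * (1 + v)" using v by (simp add: algebra_simps power2_eq_square)
          also have "\<dots> \<le> (1 - v + v\<^sup>2) * exp v"
          proof (intro mult_left_mono)
            show "0 \<le> 1 - v + v\<^sup>2" using nn[of t] by (simp add: v_def power_mult_distrib)
          qed (rule exp_ge_add_one_self)
          finally have "exp (- v) \<le> 1 - v + v\<^sup>2" by (simp add: exp_minus field_simps)
          then show ?thesis by (simp add: v_def power_mult_distrib)
        qed
        then have "ennreal (exp (s * t)) \<le> ennreal (1 + s * t + s\<^sup>2 * t\<^sup>2)" by (rule ennreal_leI)
        moreover have "ennreal (exp (s * t)) * indicator {..x / 2} t \<le> ennreal (exp (s * t))"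
          by (simp split: split_indicator)
        ultimately have "ennreal (exp (s * t)) * indicator {..x / 2} t + 0 \<le>
          ennreal (1 + s * t + s\<^sup>2 * t\<^sup>2) + ennreal (1 / L\<^sup>2) * (ennreal (w t) * indicator {Y<..} t)"
          by (intro add_mono) (auto intro: order_trans)
        then show ?thesis by simp
      next
        case False
        show ?thesis
        proof (cases "t \<le> x / 2")
          case True
          have tY: "Y < t" "L / (2 * c) \<le> t" using False invs elim(1) by (auto simp: L_def)
          have "ennreal (exp (s * t)) \<le> ennreal (1 / L\<^sup>2 * w t)"
            using pt[of t] tY True by (intro ennreal_leI) (simp add: mult.commute)
          also have "\<dots> = ennreal (1 / L\<^sup>2) * ennreal (w t)" by (rule ennreal_mult) (auto simp: w_def)
          finally have "0 + ennreal (exp (s * t)) * indicator {..x / 2} t \<le>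
            ennreal (1 + s * t + s\<^sup>2 * t\<^sup>2) + ennreal (1 / L\<^sup>2) * (ennreal (w t) * indicator {Y<..} t)"
            using True tY by (intro add_mono) auto
          then show ?thesis by simp
        qed simp
      qed
      then have "(\<integral>\<^sup>+t. ennreal (exp (s * t)) * indicator {..x / 2} t \<partial>F) \<le>
          (\<integral>\<^sup>+t. ennreal (1 + s * t + s\<^sup>2 * t\<^sup>2) + ennreal (1 / L\<^sup>2) * (ennreal (w t) * indicator {Y<..} t) \<partial>F)"
        by (intro nn_integral_mono)
      also have "\<dots> = (\<integral>\<^sup>+t. ennreal (1 + s * t + s\<^sup>2 * t\<^sup>2) \<partial>F) + ennreal (1 / L\<^sup>2) * ennreal C0"
        by (subst nn_integral_add, simp, simp, subst nn_integral_cmult, simp) (simp add: C0)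
      also have "(\<integral>\<^sup>+t. ennreal (1 + s * t + s\<^sup>2 * t\<^sup>2) \<partial>F) = ennreal (LINT t|F. 1 + s * t + s\<^sup>2 * t\<^sup>2)"
        using int1 int2 nn by (intro nn_integral_eq_integral) auto
      also have "(LINT t|F. 1 + s * t + s\<^sup>2 * t\<^sup>2) = 1 + s\<^sup>2"
        using int1 int2 mean var by (simp add: F.prob_space)
      also have "ennreal (1 + s\<^sup>2) + ennreal (1 / L\<^sup>2) * ennreal C0 = ennreal (1 + s\<^sup>2 + C0 / L\<^sup>2)"
        using C0 by (simp flip: ennreal_mult ennreal_plus)
      also have "\<dots> \<le> ennreal (1 + C / L\<^sup>2)"
      proof (rule ennreal_leI)
        have "s\<^sup>2 \<le> (2 * c / L)\<^sup>2" using s2 s0 by (intro power_mono) auto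
        then show "1 + s\<^sup>2 + C0 / L\<^sup>2 \<le> 1 + C / L\<^sup>2"
          by (simp add: C_def power_divide power_mult_distrib add_divide_distrib)
      qed
      finally show "(\<integral>\<^sup>+t. ennreal (exp (s * t)) * indicator {..x / 2} t \<partial>F) \<le> ennreal (1 + C / L\<^sup>2)" .
    next
      have Yx: "Y \<le> x / 2" "L / (2 * c) \<le> x / 2" using elim(1,2) by (auto simp: L_def)
      \<comment> \<open>Markov's inequality for the weight \<open>w\<close>, which is nondecreasing
        beyond Y; afterwards \<open>exp_tilt_bound\<close> at u = x/2 with tilt c/L trades w(x/2)
        for the exponential.\<close>
      have "ennreal (w (x / 2)) * emeasure F {x / 2<..} = (\<integral>\<^sup>+t. ennreal (w (x / 2)) * indicator {x / 2<..} t \<partial>F)"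
        by (simp add: nn_integral_cmult_indicator)
      also have "\<dots> \<le> (\<integral>\<^sup>+t. ennreal (w t) * indicator {Y<..} t \<partial>F)"
        using Yx mono[of "x / 2"] by (intro nn_integral_mono) (auto split: split_indicator intro!: ennreal_leI simp: w_def)
      finally have "ennreal (w (x / 2) * measure F {x / 2<..}) \<le> ennreal C0"
        using C0 wpos[of "x / 2"] by (simp add: F.emeasure_eq_measure ennreal_mult)
      then have tail: "w (x / 2) * measure F {x / 2<..} \<le> C0"
        using C0 by simp
      have "0 \<le> \<beta> * ln 2 / 2 / ln x" using \<beta> x1 by simp
      then have "c / L * 1 \<le> c / L * (1 + \<beta> * ln 2 / 2 / ln x)" using c L by (intro mult_left_mono) auto
      then have "c / L \<le> c / L * (1 + \<beta> * ln 2 / 2 / ln x)" by (simp only: mult_1_right)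
      then have "q * ln (x / 2) + c / L * (x / 2) - hazard c \<beta> (x / 2) \<le> - 2 * \<beta> * ln (ln x)"
        using elim(5) Yx(2) order_refl[of "x / 2"] unfolding L_def by blast
      then have "exp (c / L * (x / 2)) \<le> exp (hazard c \<beta> (x / 2) - q * ln (x / 2) + - 2 * \<beta> * ln (ln x))" by simp
      also have "\<dots> = w (x / 2) * (1 / L\<^sup>2)" unfolding exp_add Linv by (simp add: w_def)
      finally have "exp (c / L * (x / 2)) * measure F {x / 2<..} \<le> w (x / 2) * (1 / L\<^sup>2) * measure F {x / 2<..}"
        by (rule mult_right_mono) simp
      also have "\<dots> = w (x / 2) * measure F {x / 2<..} / L\<^sup>2" by simp
      also have "\<dots> \<le> C / L\<^sup>2" using tail by (intro divide_right_mono) (simp_all add: C_def add_increasing)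
      finally show "exp (c / L * (x / 2)) * measure F {x / 2<..} \<le> C / L\<^sup>2" .
    qed
  qed
  moreover have "C > 0" using C0 c by (simp add: C_def add_pos_nonneg)
  ultimately show ?thesis by blast
qed

end

section \<open>Sums of independent summands\<close>

text \<open>Fubini for the product law, with Z frozen. The outer integral stays over M, so the
  section can be estimated pathwise by other functions of \<omega>, such as indicators of a
  jump.\<close>

lemma (in prob_space) emeasure_indep_pair:
  assumes ind: "indep_var borel X borel Z" and B: "B \<in> sets (borel \<Otimes>\<^sub>M borel)"
  shows "emeasure M {\<omega> \<in> space M. (X \<omega>, Z \<omega>) \<in> B} =
    (\<integral>\<^sup>+\<omega>. emeasure (distr M borel X) {t. (t, Z \<omega>) \<in> B} \<partial>M)"
proof -
  have rv: "random_variable borel X" "random_variable borel Z"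
    and eq: "distr M borel X \<Otimes>\<^sub>M distr M borel Z = distr M (borel \<Otimes>\<^sub>M borel) (\<lambda>\<omega>. (X \<omega>, Z \<omega>))"
    using ind unfolding indep_var_distribution_eq by auto
  note rv[measurable]
  interpret X: prob_space "distr M borel X" by (rule prob_space_distr) simp
  interpret Z: prob_space "distr M borel Z" by (rule prob_space_distr) simp
  interpret P: pair_sigma_finite "distr M borel X" "distr M borel Z" ..
  have B': "B \<in> sets (distr M borel X \<Otimes>\<^sub>M distr M borel Z)"
    using B by (simp cong: sets_pair_measure_cong)
  have "emeasure M {\<omega> \<in> space M. (X \<omega>, Z \<omega>) \<in> B} = emeasure (distr M (borel \<Otimes>\<^sub>M borel) (\<lambda>\<omega>. (X \<omega>, Z \<omega>))) B"
    using B by (subst emeasure_distr) (auto intro!: arg_cong[where f = "emeasure M"])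
  also have "\<dots> = (\<integral>\<^sup>+y. emeasure (distr M borel X) ((\<lambda>t. (t, y)) -` B) \<partial>distr M borel Z)"
    unfolding eq[symmetric] by (rule P.emeasure_pair_measure_alt2[OF B'])
  also have "\<dots> = (\<integral>\<^sup>+\<omega>. emeasure (distr M borel X) ((\<lambda>t. (t, Z \<omega>)) -` B) \<partial>M)"
    by (rule nn_integral_distr) (use P.measurable_emeasure_Pair2[OF B'] in auto)
  finally show ?thesis by (simp add: vimage_def)
qed

locale iid_semiexponential = semiexponential F T p c \<beta> + M: prob_space M
  for F :: "real measure" and T :: ereal and p :: "real \<Rightarrow> real" and c \<beta> :: real and M :: "'a measure" +
  fixes \<xi> :: "nat \<Rightarrow> 'a \<Rightarrow> real"
  assumes indep: "M.indep_vars (\<lambda>_. borel) \<xi> UNIV"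
    and dist: "\<And>i. distr M borel (\<xi> i) = F"
begin

lemma rv [measurable]: "\<xi> i \<in> borel_measurable M"
  using indep by (simp add: M.indep_vars_def)

abbreviation rsum :: "nat set \<Rightarrow> 'a \<Rightarrow> real" where "rsum J \<omega> \<equiv> \<Sum>j\<in>J. \<xi> j \<omega>"

definition no_jump_above :: "nat set \<Rightarrow> real \<Rightarrow> 'a set" where
  "no_jump_above J b = {\<omega> \<in> space M. \<forall>j\<in>J. \<xi> j \<omega> \<le> b}"

lemma no_jump_above_measurable [measurable]: "finite J \<Longrightarrow> no_jump_above J b \<in> sets M"
  unfolding no_jump_above_def by measurable

lemma indep_rest:
  assumes "finite J" "i \<notin> J" and f: "f \<in> borel_measurable (PiM J (\<lambda>_. borel))"
  shows "M.indep_var borel (\<xi> i) borel (\<lambda>\<omega>. f (restrict (\<lambda>j. \<xi> j \<omega>) J))"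
proof -
  have "M.indep_var borel ((\<lambda>g. g i) \<circ> (\<lambda>\<omega>. restrict (\<lambda>j. \<xi> j \<omega>) {i}))
      borel (f \<circ> (\<lambda>\<omega>. restrict (\<lambda>j. \<xi> j \<omega>) J))"
    using assms by (intro M.indep_var_compose[OF M.indep_var_restrict[OF indep]]) auto
  then show ?thesis by (simp add: comp_def)
qed

lemma rsum_second_moment:
  assumes "finite J"
  shows "integrable M (rsum J) \<and> (LINT \<omega>|M. rsum J \<omega>) = 0 \<and>
    integrable M (\<lambda>\<omega>. (rsum J \<omega>)\<^sup>2) \<and> (LINT \<omega>|M. (rsum J \<omega>)\<^sup>2) = real (card J)"
  using assms
proof induction
  case (insert i J)
  have id_m: "(\<lambda>t::real. t) \<in> borel_measurable borel" by simp
  have X: "integrable M (\<xi> i)" "(LINT \<omega>|M. \<xi> i \<omega>) = 0"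
    using int1 mean unfolding dist[of i, symmetric]
    by (simp_all only: integrable_distr_eq[OF rv id_m] integral_distr[OF rv id_m])
  have sq_m: "(\<lambda>t::real. t\<^sup>2) \<in> borel_measurable borel" by simp
  have X2: "integrable M (\<lambda>\<omega>. (\<xi> i \<omega>)\<^sup>2)" "(LINT \<omega>|M. (\<xi> i \<omega>)\<^sup>2) = 1"
    using int2 var unfolding dist[of i, symmetric]
    by (simp_all only: integrable_distr_eq[OF rv sq_m] integral_distr[OF rv sq_m])
  have ind: "M.indep_var borel (\<xi> i) borel (rsum J)"
    using insert.hyps M.indep_vars_subset[OF indep, of "insert i J"] by (intro M.indep_vars_sum) auto
  have I: "integrable M (\<lambda>\<omega>. \<xi> i \<omega> * rsum J \<omega>)" "(LINT \<omega>|M. \<xi> i \<omega> * rsum J \<omega>) = 0"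
    using M.indep_var_integrable[OF ind] M.indep_var_lebesgue_integral[OF ind] X insert.IH by auto
  have sq: "(rsum (insert i J) \<omega>)\<^sup>2 = (\<xi> i \<omega>)\<^sup>2 + (rsum J \<omega>)\<^sup>2 + 2 * (\<xi> i \<omega> * rsum J \<omega>)" for \<omega>
    using insert.hyps by (simp add: power2_sum)
  have "integrable M (\<lambda>\<omega>. (rsum (insert i J) \<omega>)\<^sup>2)"
    unfolding sq using I X2 insert.IH by auto
  moreover have "(LINT \<omega>|M. (rsum (insert i J) \<omega>)\<^sup>2) = real (card (insert i J))"
    unfolding sq using I X2 insert.IH insert.hyps by simp
  moreover have "rsum (insert i J) = (\<lambda>\<omega>. \<xi> i \<omega> + rsum J \<omega>)" using insert.hyps by auto
  then have "integrable M (rsum (insert i J)) \<and> (LINT \<omega>|M. rsum (insert i J) \<omega>) = 0"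
    using X insert.IH by simp
  ultimately show ?case by blast
qed simp

lemma rsum_Chebyshev:
  assumes J: "finite J" and y: "0 < y"
  shows "measure M {\<omega> \<in> space M. y \<le> \<bar>rsum J \<omega>\<bar>} \<le> real (card J) / y\<^sup>2"
  using M.Chebyshev_inequality[of "rsum J" y] rsum_second_moment[OF J] y by simp

text \<open>Both the exponential and the indicator of the absence of jumps factor over the
  indices.\<close>

lemma tilted_sum:
  assumes J: "finite J"
  shows "(\<integral>\<^sup>+\<omega>. ennreal (exp (s * rsum J \<omega>)) * indicator (no_jump_above J b) \<omega> \<partial>M) =
    (\<integral>\<^sup>+t. ennreal (exp (s * t)) * indicator {..b} t \<partial>F) ^ card J"
proof -
  define X where "X i \<omega> = ennreal (exp (s * \<xi> i \<omega>)) * indicator {..b} (\<xi> i \<omega>)" for i \<omega>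
  have marginal: "(\<integral>\<^sup>+\<omega>. X i \<omega> \<partial>M) = (\<integral>\<^sup>+t. ennreal (exp (s * t)) * indicator {..b} t \<partial>F)" for i
    unfolding X_def dist[of i, symmetric] by (rule nn_integral_distr[symmetric]) auto
  have "ennreal (exp (s * rsum J \<omega>)) * indicator (no_jump_above J b) \<omega> = (\<Prod>i\<in>J. X i \<omega>)" if "\<omega> \<in> space M" for \<omega>
    using J
  proof induction
    case empty
    then show ?case using that by (simp add: no_jump_above_def)
  next
    case (insert i J)
    have "indicator (no_jump_above (insert i J) b) \<omega> = (indicator {..b} (\<xi> i \<omega>) * indicator (no_jump_above J b) \<omega> :: ennreal)"
      using that by (simp add: no_jump_above_def indicator_def)
    then show ?case using insert
      by (simp add: X_def distrib_left exp_add ennreal_mult insert.IH[symmetric] mult_ac)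
  qed
  then have "(\<integral>\<^sup>+\<omega>. ennreal (exp (s * rsum J \<omega>)) * indicator (no_jump_above J b) \<omega> \<partial>M) = (\<integral>\<^sup>+\<omega>. (\<Prod>i\<in>J. X i \<omega>) \<partial>M)"
    by (intro nn_integral_cong)
  also have "\<dots> = (\<Prod>i\<in>J. \<integral>\<^sup>+\<omega>. X i \<omega> \<partial>M)"
    using J unfolding X_def
    by (intro M.indep_vars_nn_integral M.indep_vars_compose2[OF M.indep_vars_subset[OF indep]]) auto
  also have "\<dots> = (\<integral>\<^sup>+t. ennreal (exp (s * t)) * indicator {..b} t \<partial>F) ^ card J"
    by (simp add: marginal)
  finally show ?thesis .
qed

lemma prob_jump_above:
  assumes J: "finite J"
  shows "measure M (space M - no_jump_above J b) \<le> real (card J) * measure F {b<..}"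
proof -
  have "space M - no_jump_above J b = (\<Union>j\<in>J. {\<omega> \<in> space M. b < \<xi> j \<omega>})"
    by (auto simp: no_jump_above_def not_le)
  also have "measure M \<dots> \<le> (\<Sum>j\<in>J. measure M {\<omega> \<in> space M. b < \<xi> j \<omega>})"
    using J by (intro M.finite_measure_subadditive_finite) auto
  also have "\<dots> = (\<Sum>j\<in>J. measure F {b<..})"
  proof (rule sum.cong)
    fix j
    have "measure F {b<..} = measure (distr M borel (\<xi> j)) {b<..}" by (simp add: dist)
    also have "\<dots> = measure M {\<omega> \<in> space M. b < \<xi> j \<omega>}"
      by (subst measure_distr) (auto intro!: arg_cong[where f = "measure M"])
    finally show "measure M {\<omega> \<in> space M. b < \<xi> j \<omega>} = measure F {b<..}" ..
  qed simp
  finally show ?thesis by simp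
qed

text \<open>Chebyshev and a union bound. It bounds the typical event from below, both directly in
  the lower bound and as the part to be subtracted in the upper bound.\<close>

lemma prob_central:
  assumes J: "finite J" and y: "0 < y"
  shows "1 - real (card J) / y\<^sup>2 - real (card J) * measure F {b<..} \<le>
    measure M {\<omega> \<in> no_jump_above J b. \<bar>rsum J \<omega>\<bar> \<le> y}"
proof -
  have "1 = measure M (space M)" by (simp add: M.prob_space)
  also have "\<dots> \<le> measure M ({\<omega> \<in> no_jump_above J b. \<bar>rsum J \<omega>\<bar> \<le> y} \<union> ({\<omega> \<in> space M. y \<le> \<bar>rsum J \<omega>\<bar>} \<union> (space M - no_jump_above J b)))"
    using J by (intro M.finite_measure_mono) (auto simp: no_jump_above_def)
  also have "\<dots> \<le> measure M {\<omega> \<in> no_jump_above J b. \<bar>rsum J \<omega>\<bar> \<le> y} + measure M ({\<omega> \<in> space M. y \<le> \<bar>rsum J \<omega>\<bar>} \<union> (space M - no_jump_above J b))"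
    using J by (intro measure_Un_le) (auto simp: no_jump_above_def)
  also have "\<dots> \<le> measure M {\<omega> \<in> no_jump_above J b. \<bar>rsum J \<omega>\<bar> \<le> y} + (measure M {\<omega> \<in> space M. y \<le> \<bar>rsum J \<omega>\<bar>} + measure M (space M - no_jump_above J b))"
    using J by (intro add_left_mono measure_Un_le) auto
  finally show ?thesis using rsum_Chebyshev[OF J y] prob_jump_above[OF J, of b] by linarith
qed

lemma shifted_Delta_translate: "{t. t + u \<in> shifted_Delta T x} = shifted_Delta T (x - u)"
  by (auto simp: mem_shifted_Delta algebra_simps)

section \<open>Lower bound from disjoint single-jump events\<close>

text \<open>Non-asymptotic form: E is the insensitivity factor on the window [-y, y], n/y^2 is the
  Chebyshev loss for the other summands, and the last term is the loss from a second jump.\<close>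

lemma lower_bound:
  assumes y: "0 < y" "y \<le> x / 2" and E: "0 < E"
    and ins: "\<And>u. \<bar>u\<bar> \<le> y \<Longrightarrow> G x \<le> E * G (x - u)"
  shows "real n * (G x / E) * (1 - real n / y\<^sup>2 - real n * measure F {x / 2<..}) \<le>
    measure M {\<omega> \<in> space M. rsum {1..n} \<omega> \<in> shifted_Delta T x}"
proof -
  define J where "J i = {1..n} - {i}" for i
  have J: "finite (J i)" "i \<notin> J i" for i by (auto simp: J_def)
  \<comment> \<open>\<open>y + 1\<close> is a mark outside the window \<open>[-y, y]\<close> for the case of a second big jump.\<close>
  define f where "f i g = (if \<forall>j\<in>J i. g j \<le> x / 2 then \<Sum>j\<in>J i. g j else y + 1)" for i and g :: "nat \<Rightarrow> real"
  define Z where "Z i \<omega> = f i (restrict (\<lambda>j. \<xi> j \<omega>) (J i))" for i \<omega>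
  have fm: "f i \<in> borel_measurable (PiM (J i) (\<lambda>_. borel))" for i
    unfolding f_def using J by measurable
  have Z: "Z i \<omega> = (if \<omega> \<in> no_jump_above (J i) (x / 2) then rsum (J i) \<omega> else y + 1)" if "\<omega> \<in> space M" for i \<omega>
    using that by (auto simp: Z_def f_def no_jump_above_def)
  have Zm [measurable]: "Z i \<in> borel_measurable M" for i
  proof -
    have "Z i = (\<lambda>\<omega>. f i (restrict (\<lambda>j. \<xi> j \<omega>) (J i)))" by (simp add: Z_def fun_eq_iff)
    then show ?thesis using M.indep_var_rv2[OF indep_rest[OF J fm, of i]] by simp
  qed
  define A where "A i = {\<omega> \<in> space M. \<bar>Z i \<omega>\<bar> \<le> y \<and> \<xi> i \<omega> + Z i \<omega> \<in> shifted_Delta T x}" for i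
  have Am [measurable]: "A i \<in> sets M" for i unfolding A_def by measurable
  have A: "\<omega> \<in> space M \<and> \<omega> \<in> no_jump_above (J i) (x / 2) \<and> \<bar>rsum (J i) \<omega>\<bar> \<le> y \<and> \<xi> i \<omega> + rsum (J i) \<omega> \<in> shifted_Delta T x"
    if "\<omega> \<in> A i" for i \<omega>
    using that Z[of \<omega> i] y by (auto simp: A_def split: if_splits)
  have S: "rsum {1..n} \<omega> = \<xi> i \<omega> + rsum (J i) \<omega>" if "i \<in> {1..n}" for i \<omega>
    unfolding J_def using that by (subst sum.remove[of _ i]) auto
  \<comment> \<open>On \<open>A i\<close> the i-th summand exceeds x - y \<ge> x/2, which
    \<open>A k\<close> forbids.\<close>
  have disj: "disjoint_family_on A {1..n}"
    unfolding disjoint_family_on_def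
  proof (intro ballI impI equals0I)
    fix i k \<omega> assume ik: "i \<in> {1..n}" "k \<in> {1..n}" "i \<noteq> k" and \<omega>: "\<omega> \<in> A i \<inter> A k"
    have \<omega>i: "\<omega> \<in> A i" and \<omega>k: "\<omega> \<in> A k" using \<omega> by simp_all
    have "i \<in> J k" using ik by (simp add: J_def)
    then have "\<xi> i \<omega> \<le> x / 2" using A[OF \<omega>k] by (simp add: no_jump_above_def)
    moreover have "\<bar>rsum (J i) \<omega>\<bar> \<le> y" "x < \<xi> i \<omega> + rsum (J i) \<omega>"
      using A[OF \<omega>i] by (simp_all add: mem_shifted_Delta)
    then have "x - y < \<xi> i \<omega>" by linarith
    ultimately show False using y by linarith
  qed
  have PA: "G x / E * (1 - real n / y\<^sup>2 - real n * measure F {x / 2<..}) \<le> measure M (A i)" if i: "i \<in> {1..n}" for i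
  proof -
    define B where "B = {(t, u). \<bar>u\<bar> \<le> y \<and> t + u \<in> shifted_Delta T x}"
    have "B = {z \<in> space (borel \<Otimes>\<^sub>M borel). \<bar>snd z\<bar> \<le> y \<and> fst z + snd z \<in> shifted_Delta T x}"
      by (auto simp: B_def space_pair_measure)
    also have "\<dots> \<in> sets (borel \<Otimes>\<^sub>M borel)" by measurable
    finally have Bm: "B \<in> sets (borel \<Otimes>\<^sub>M borel)" .
    define H where "H = {\<omega> \<in> no_jump_above (J i) (x / 2). \<bar>rsum (J i) \<omega>\<bar> \<le> y}"
    have Hm [measurable]: "H \<in> sets M"
    proof -
      have "H = {\<omega> \<in> space M. \<omega> \<in> no_jump_above (J i) (x / 2) \<and> \<bar>rsum (J i) \<omega>\<bar> \<le> y}" by (auto simp: H_def no_jump_above_def)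
      then show ?thesis using no_jump_above_measurable[OF J(1)] by simp
    qed
    have "ennreal (G x / E * measure M H) = ennreal (G x / E) * emeasure M H"
      unfolding M.emeasure_eq_measure using E by (intro ennreal_mult) (simp_all add: G_def)
    also have "\<dots> = (\<integral>\<^sup>+\<omega>. ennreal (G x / E) * indicator H \<omega> \<partial>M)"
      by (rule nn_integral_cmult_indicator[symmetric]) (rule Hm)
    also have "\<dots> \<le> (\<integral>\<^sup>+\<omega>. emeasure F {t. (t, Z i \<omega>) \<in> B} \<partial>M)"
    proof (rule nn_integral_mono)
      fix \<omega> assume \<omega>: "\<omega> \<in> space M"
      show "ennreal (G x / E) * indicator H \<omega> \<le> emeasure F {t. (t, Z i \<omega>) \<in> B}"
      proof (cases "\<omega> \<in> H")
        case True
        then have "\<omega> \<in> no_jump_above (J i) (x / 2)" "\<bar>rsum (J i) \<omega>\<bar> \<le> y" by (simp_all add: H_def)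
        then have Zy: "\<bar>Z i \<omega>\<bar> \<le> y" by (simp add: Z[OF \<omega>])
        have "{t. (t, Z i \<omega>) \<in> B} = {t. t + Z i \<omega> \<in> shifted_Delta T x}"
          using Zy by (simp add: B_def)
        then have "{t. (t, Z i \<omega>) \<in> B} = shifted_Delta T (x - Z i \<omega>)"
          by (simp only: shifted_Delta_translate)
        moreover have "G x / E \<le> G (x - Z i \<omega>)" using ins[OF Zy] E by (simp add: field_simps)
        ultimately show ?thesis using True by (simp add: F.emeasure_eq_measure G_def[symmetric] ennreal_leI)
      qed simp
    qed
    also have "\<dots> = emeasure M {\<omega> \<in> space M. (\<xi> i \<omega>, Z i \<omega>) \<in> B}"
      using M.emeasure_indep_pair[OF indep_rest[OF J fm] Bm, of i] by (simp add: dist Z_def)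
    also have "{\<omega> \<in> space M. (\<xi> i \<omega>, Z i \<omega>) \<in> B} = A i" by (auto simp: A_def B_def)
    finally have *: "G x / E * measure M H \<le> measure M (A i)"
      by (simp add: M.emeasure_eq_measure)
    have "real (card (J i)) \<le> real n" using i by (simp add: J_def)
    then have "real (card (J i)) / y\<^sup>2 \<le> real n / y\<^sup>2"
      "real (card (J i)) * measure F {x / 2<..} \<le> real n * measure F {x / 2<..}"
      by (auto intro!: divide_right_mono mult_right_mono)
    then have "1 - real n / y\<^sup>2 - real n * measure F {x / 2<..} \<le> measure M H"
      using prob_central[OF J(1)[of i] y(1), of "x / 2"] unfolding H_def by linarith
    then have "G x / E * (1 - real n / y\<^sup>2 - real n * measure F {x / 2<..}) \<le> G x / E * measure M H"
      using E by (intro mult_left_mono) (auto simp: G_def)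
    then show ?thesis using * by linarith
  qed
  have "real n * (G x / E) * (1 - real n / y\<^sup>2 - real n * measure F {x / 2<..}) =
      (\<Sum>i\<in>{1..n}. G x / E * (1 - real n / y\<^sup>2 - real n * measure F {x / 2<..}))" by simp
  also have "\<dots> \<le> (\<Sum>i\<in>{1..n}. measure M (A i))" by (intro sum_mono PA)
  also have "\<dots> = measure M (\<Union>i\<in>{1..n}. A i)"
    by (intro M.finite_measure_finite_Union[symmetric] disj) auto
  also have "\<dots> \<le> measure M {\<omega> \<in> space M. rsum {1..n} \<omega> \<in> shifted_Delta T x}"
    using A S by (intro M.finite_measure_mono) auto
  finally show ?thesis .
qed

section \<open>Upper bound by splitting on a summand above x/2\<close>

text \<open>When u > x/2 the constraint t > x/2 is the binding one and the section lies in x/2 +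
  Delta. The shift is thus capped at x/2, exactly the range of the backward bound.\<close>

lemma big_jump_section_le:
  "emeasure F {t. x / 2 < t \<and> t + u \<in> shifted_Delta T x} \<le> ennreal (G (x - min u (x / 2)))"
proof -
  have "{t. x / 2 < t \<and> t + u \<in> shifted_Delta T x} \<subseteq> shifted_Delta T (x - min u (x / 2))"
  proof (cases "u \<le> x / 2")
    case True
    then show ?thesis by (auto simp: mem_shifted_Delta algebra_simps)
  next
    case False
    then have le: "ereal (t - x / 2) \<le> ereal (t + u - x)" for t by simp
    show ?thesis using False by (auto simp: mem_shifted_Delta intro: order_trans[OF le])
  qed
  then show ?thesis
    unfolding G_def F.emeasure_eq_measure[symmetric] by (rule emeasure_mono) simp
qed

text \<open>With S' the sum over J: E comes from |S'| \<le> y, n/y^2 from S' < -y, the difference of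
  tilted masses from S' > y without a second jump, and n D from a second jump, where the capped
  shift costs at most exp(s x/2).\<close>

lemma single_jump_bound:
  assumes J: "finite J" "i \<notin> J" "card J \<le> n" and y: "0 < y" "y \<le> x / 2"
    and nonneg: "0 \<le> E" "0 \<le> K" "0 \<le> D" "0 \<le> s"
    and ins: "\<And>u. \<bar>u\<bar> \<le> y \<Longrightarrow> G (x - u) \<le> E * G x"
    and fwd: "\<And>z. x \<le> z \<Longrightarrow> G z \<le> K * G x"
    and bwd: "\<And>u. 0 \<le> u \<Longrightarrow> u \<le> x / 2 \<Longrightarrow> G (x - u) \<le> K * exp (s * u) * G x"
    and mgf: "(\<integral>\<^sup>+t. ennreal (exp (s * t)) * indicator {..x / 2} t \<partial>F) \<le> ennreal (1 + D)"
    and tail: "exp (s * (x / 2)) * measure F {x / 2<..} \<le> D"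
  shows "measure M {\<omega> \<in> space M. x / 2 < \<xi> i \<omega> \<and> \<xi> i \<omega> + rsum J \<omega> \<in> shifted_Delta T x} \<le>
    G x * (E + K * (real n / y\<^sup>2 + ((1 + D) ^ n - exp (- s * y) * (1 - real n / y\<^sup>2 - real n * D)) + real n * D))"
proof -
  define e where "e = exp (s * (x / 2))"
  define P where "P = {\<omega> \<in> space M. y \<le> \<bar>rsum J \<omega>\<bar>}"
  define Q where "Q = {\<omega> \<in> space M. y < rsum J \<omega>}"
  define H where "H = {\<omega> \<in> no_jump_above J (x / 2). \<bar>rsum J \<omega>\<bar> \<le> y}"
  define f where "f \<omega> = ennreal (exp (s * rsum J \<omega>)) * indicator (no_jump_above J (x / 2)) \<omega>" for \<omega>
  have bm [measurable]: "no_jump_above J (x / 2) \<in> sets M" by (rule no_jump_above_measurable[OF J(1)])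
  have [measurable]: "P \<in> sets M" "Q \<in> sets M" unfolding P_def Q_def by measurable
  have H': "H = no_jump_above J (x / 2) \<inter> {\<omega> \<in> space M. \<bar>rsum J \<omega>\<bar> \<le> y}" by (auto simp: H_def no_jump_above_def)
  have Hm [measurable]: "H \<in> sets M" unfolding H' by measurable
  have [measurable]: "f \<in> borel_measurable M" unfolding f_def by measurable
  have Gn: "0 \<le> G z" for z by (simp add: G_def)
  have x: "0 < x" using y by simp
  have tail': "measure F {x / 2<..} \<le> D"
  proof -
    have "1 * measure F {x / 2<..} \<le> exp (s * (x / 2)) * measure F {x / 2<..}"
      using nonneg x by (intro mult_right_mono) auto
    then show ?thesis using tail by simp
  qed
  have cardJ: "real (card J) / y\<^sup>2 \<le> real n / y\<^sup>2" "real (card J) * D \<le> real n * D"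
    using J nonneg by (auto intro!: divide_right_mono mult_right_mono)
  have PP: "measure M P \<le> real n / y\<^sup>2"
    using rsum_Chebyshev[OF J(1) y(1)] cardJ unfolding P_def by linarith
  have PH: "1 - real n / y\<^sup>2 - real n * D \<le> measure M H"
    using prob_central[OF J(1) y(1), of "x / 2"] cardJ mult_left_mono[OF tail', of "real (card J)"]
    unfolding H_def by simp
  have PN: "e * measure M (space M - no_jump_above J (x / 2)) \<le> real n * D"
  proof -
    have "e * measure M (space M - no_jump_above J (x / 2)) \<le> e * (real (card J) * measure F {x / 2<..})"
      using prob_jump_above[OF J(1)] by (intro mult_left_mono) (auto simp: e_def)
    also have "\<dots> = real (card J) * (e * measure F {x / 2<..})" by simp
    also have "\<dots> \<le> real (card J) * D" using tail by (intro mult_left_mono) (auto simp: e_def)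
    finally show ?thesis using cardJ by linarith
  qed
  define X where "X = (\<integral>\<^sup>+\<omega>. f \<omega> * indicator Q \<omega> \<partial>M)"
  \<comment> \<open>\<open>Q\<close> and \<open>H\<close> are disjoint and the tilted weight is at
    least exp(-s y) on \<open>H\<close>, so the part over \<open>Q\<close> is bounded by the total
    minus the central part.\<close>
  have "X + ennreal (exp (- s * y) * measure M H) = X + (\<integral>\<^sup>+\<omega>. ennreal (exp (- s * y)) * indicator H \<omega> \<partial>M)"
    by (simp add: nn_integral_cmult_indicator M.emeasure_eq_measure ennreal_mult)
  also have "\<dots> = (\<integral>\<^sup>+\<omega>. f \<omega> * indicator Q \<omega> + ennreal (exp (- s * y)) * indicator H \<omega> \<partial>M)"
    unfolding X_def by (rule nn_integral_add[symmetric]) measurable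
  also have "\<dots> \<le> (\<integral>\<^sup>+\<omega>. f \<omega> \<partial>M)"
  proof (rule nn_integral_mono)
    fix \<omega> assume \<omega>: "\<omega> \<in> space M"
    show "f \<omega> * indicator Q \<omega> + ennreal (exp (- s * y)) * indicator H \<omega> \<le> f \<omega>"
    proof (cases "\<omega> \<in> H")
      case True
      then have "\<omega> \<in> no_jump_above J (x / 2)" and abs: "\<bar>rsum J \<omega>\<bar> \<le> y" by (simp_all add: H_def)
      moreover have "\<omega> \<notin> Q" using abs_le_D1[OF abs] by (simp add: Q_def)
      moreover from abs have "s * (- y) \<le> s * rsum J \<omega>" using nonneg by (intro mult_left_mono) auto
      ultimately show ?thesis using True by (simp add: f_def ennreal_leI)
    next
      case False
      then show ?thesis by (simp split: split_indicator)
    qed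
  qed
  also have "\<dots> \<le> ennreal (1 + D) ^ card J"
    unfolding f_def tilted_sum[OF J(1)] by (intro power_mono mgf) simp
  also have "\<dots> = ennreal ((1 + D) ^ card J)" using nonneg by (intro ennreal_power) simp
  also have "\<dots> \<le> ennreal ((1 + D) ^ n)" using nonneg J by (intro ennreal_leI power_increasing) auto
  finally have Xle: "X + ennreal (exp (- s * y) * measure M H) \<le> ennreal ((1 + D) ^ n)" .
  then have "X < \<top>" by (metis add_increasing2 ennreal_less_top le_less_trans zero_le order_refl)
  then obtain X' where X': "X = ennreal X'" "0 \<le> X'" by (cases X) auto
  have "X' + exp (- s * y) * measure M H \<le> (1 + D) ^ n"
    using Xle X' nonneg by (simp flip: ennreal_plus)
  moreover have "exp (- s * y) * (1 - real n / y\<^sup>2 - real n * D) \<le> exp (- s * y) * measure M H"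
    using PH by (intro mult_left_mono) auto
  ultimately have X'le: "X' \<le> (1 + D) ^ n - exp (- s * y) * (1 - real n / y\<^sup>2 - real n * D)" by linarith

  define B where "B = {(t, u). x / 2 < t \<and> t + u \<in> shifted_Delta T x}"
  have "B = {z \<in> space (borel \<Otimes>\<^sub>M borel). x / 2 < fst z \<and> fst z + snd z \<in> shifted_Delta T x}"
    by (auto simp: B_def space_pair_measure)
  also have "\<dots> \<in> sets (borel \<Otimes>\<^sub>M borel)" by measurable
  finally have Bm: "B \<in> sets (borel \<Otimes>\<^sub>M borel)" .
  have ind: "M.indep_var borel (\<xi> i) borel (rsum J)"
    using J M.indep_vars_subset[OF indep, of "insert i J"] by (intro M.indep_vars_sum) auto
  have "emeasure M {\<omega> \<in> space M. x / 2 < \<xi> i \<omega> \<and> \<xi> i \<omega> + rsum J \<omega> \<in> shifted_Delta T x} =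
      emeasure M {\<omega> \<in> space M. (\<xi> i \<omega>, rsum J \<omega>) \<in> B}" by (simp add: B_def)
  also have "\<dots> = (\<integral>\<^sup>+\<omega>. emeasure F {t. x / 2 < t \<and> t + rsum J \<omega> \<in> shifted_Delta T x} \<partial>M)"
    unfolding M.emeasure_indep_pair[OF ind Bm] dist by (simp add: B_def)
  also have "\<dots> \<le> (\<integral>\<^sup>+\<omega>. ennreal (E * G x) + ennreal (K * G x) *
      (indicator P \<omega> + (f \<omega> * indicator Q \<omega> + ennreal e * indicator (space M - no_jump_above J (x / 2)) \<omega>)) \<partial>M)"
  proof (rule nn_integral_mono)
    fix \<omega> assume \<omega>: "\<omega> \<in> space M"
    define u where "u = rsum J \<omega>"
    have sec: "emeasure F {t. x / 2 < t \<and> t + u \<in> shifted_Delta T x} \<le> ennreal (G (x - min u (x / 2)))"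
      by (rule big_jump_section_le)
    \<comment> \<open>Each case is charged to one place of the majorant: the constant E, the
      indicator of \<open>P\<close>, or the two terms that separate the presence and absence of a
      second jump.\<close>
    consider "\<bar>u\<bar> \<le> y" | "u < - y" | "y < u" by linarith
    then show "emeasure F {t. x / 2 < t \<and> t + rsum J \<omega> \<in> shifted_Delta T x} \<le> ennreal (E * G x) + ennreal (K * G x) *
      (indicator P \<omega> + (f \<omega> * indicator Q \<omega> + ennreal e * indicator (space M - no_jump_above J (x / 2)) \<omega>))"
      unfolding u_def[symmetric]
    proof cases
      case 1
      then have "min u (x / 2) = u" using y by linarith
      then have "ennreal (G (x - min u (x / 2))) \<le> ennreal (E * G x)" using ins[OF 1] by (simp add: ennreal_leI)
      then show "emeasure F {t. x / 2 < t \<and> t + u \<in> shifted_Delta T x} \<le> ennreal (E * G x) + ennreal (K * G x) *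
      (indicator P \<omega> + (f \<omega> * indicator Q \<omega> + ennreal e * indicator (space M - no_jump_above J (x / 2)) \<omega>))"
        using sec by (intro add_increasing2) (auto intro: order_trans)
    next
      case 2
      then have "\<omega> \<in> P" using \<omega> by (simp add: P_def u_def)
      have "min u (x / 2) = u" "x \<le> x - u" using 2 y by linarith+
      then have "ennreal (G (x - min u (x / 2))) \<le> ennreal (K * G x)" using fwd[of "x - u"] by (simp add: ennreal_leI)
      also have "\<dots> = ennreal (K * G x) * (1 + 0)" by simp
      also have "\<dots> \<le> ennreal (K * G x) *
        (indicator P \<omega> + (f \<omega> * indicator Q \<omega> + ennreal e * indicator (space M - no_jump_above J (x / 2)) \<omega>))"
        using \<open>\<omega> \<in> P\<close> by (intro mult_left_mono add_mono) auto
      finally show "emeasure F {t. x / 2 < t \<and> t + u \<in> shifted_Delta T x} \<le> ennreal (E * G x) + ennreal (K * G x) *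
      (indicator P \<omega> + (f \<omega> * indicator Q \<omega> + ennreal e * indicator (space M - no_jump_above J (x / 2)) \<omega>))"
        using sec by (intro add_increasing) (auto intro: order_trans)
    next
      case 3
      then have "\<omega> \<in> Q" using \<omega> by (simp add: Q_def u_def)
      have "s * min u (x / 2) \<le> s * u" "s * min u (x / 2) \<le> s * (x / 2)"
        using nonneg by (auto intro!: mult_left_mono simp del: times_divide_eq_right)
      then have "exp (s * min u (x / 2)) \<le> exp (s * u)" "exp (s * min u (x / 2)) \<le> e"
        by (simp_all only: e_def exp_le_cancel_iff)
      then have "ennreal (exp (s * min u (x / 2))) \<le> f \<omega> * indicator Q \<omega> + ennreal e * indicator (space M - no_jump_above J (x / 2)) \<omega>"
        using \<open>\<omega> \<in> Q\<close> \<omega> by (cases "\<omega> \<in> no_jump_above J (x / 2)") (simp_all add: f_def u_def ennreal_leI)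
      then have *: "ennreal (K * G x) * ennreal (exp (s * min u (x / 2))) \<le> ennreal (K * G x) *
        (0 + (f \<omega> * indicator Q \<omega> + ennreal e * indicator (space M - no_jump_above J (x / 2)) \<omega>))"
        by (intro mult_left_mono) simp_all
      have "G (x - min u (x / 2)) \<le> K * exp (s * min u (x / 2)) * G x"
        using 3 y by (intro bwd) auto
      then have "ennreal (G (x - min u (x / 2))) \<le> ennreal (K * G x * exp (s * min u (x / 2)))"
        by (intro ennreal_leI) (simp add: mult_ac)
      also have "\<dots> = ennreal (K * G x) * ennreal (exp (s * min u (x / 2)))"
        using nonneg Gn by (intro ennreal_mult) auto
      also note *
      also have "ennreal (K * G x) *
        (0 + (f \<omega> * indicator Q \<omega> + ennreal e * indicator (space M - no_jump_above J (x / 2)) \<omega>)) \<le> ennreal (K * G x) *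
        (indicator P \<omega> + (f \<omega> * indicator Q \<omega> + ennreal e * indicator (space M - no_jump_above J (x / 2)) \<omega>))"
        by (intro mult_left_mono add_mono) auto
      finally show "emeasure F {t. x / 2 < t \<and> t + u \<in> shifted_Delta T x} \<le> ennreal (E * G x) + ennreal (K * G x) *
      (indicator P \<omega> + (f \<omega> * indicator Q \<omega> + ennreal e * indicator (space M - no_jump_above J (x / 2)) \<omega>))"
        using sec by (intro add_increasing) (auto intro: order_trans)
    qed
  qed
  also have "\<dots> = ennreal (E * G x) + ennreal (K * G x) *
      (emeasure M P + (X + ennreal e * emeasure M (space M - no_jump_above J (x / 2))))"
    unfolding X_def
    by (subst nn_integral_add, simp, simp, subst nn_integral_cmult, simp, subst nn_integral_add, simp, simp,
        subst nn_integral_add, simp, simp, subst nn_integral_cmult_indicator, simp)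
       (simp add: M.emeasure_space_1)
  also have "\<dots> = ennreal (E * G x + K * G x * (measure M P + (X' + e * measure M (space M - no_jump_above J (x / 2)))))"
    using nonneg Gn X' by (simp add: M.emeasure_eq_measure e_def flip: ennreal_mult ennreal_plus)
  finally have "ennreal (measure M {\<omega> \<in> space M. x / 2 < \<xi> i \<omega> \<and> \<xi> i \<omega> + rsum J \<omega> \<in> shifted_Delta T x}) \<le>
      ennreal (E * G x + K * G x * (measure M P + (X' + e * measure M (space M - no_jump_above J (x / 2)))))"
    by (simp only: M.emeasure_eq_measure)
  moreover have "0 \<le> E * G x + K * G x * (measure M P + (X' + e * measure M (space M - no_jump_above J (x / 2))))"
    using nonneg Gn X' by (intro add_nonneg_nonneg mult_nonneg_nonneg) (simp_all add: e_def)
  ultimately have "measure M {\<omega> \<in> space M. x / 2 < \<xi> i \<omega> \<and> \<xi> i \<omega> + rsum J \<omega> \<in> shifted_Delta T x} \<le>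
      E * G x + K * G x * (measure M P + (X' + e * measure M (space M - no_jump_above J (x / 2))))"
    by (simp only: ennreal_le_iff)
  also have "\<dots> \<le> E * G x + K * G x * (real n / y\<^sup>2 + (((1 + D) ^ n - exp (- s * y) * (1 - real n / y\<^sup>2 - real n * D)) + real n * D))"
    using PP X'le PN nonneg Gn by (intro add_left_mono mult_left_mono add_mono) auto
  finally show ?thesis by (simp add: algebra_simps)
qed

text \<open>Exponential Markov inequality: hitting the window forces the sum above x.\<close>

lemma no_big_jump_bound:
  assumes nonneg: "0 \<le> D" "0 \<le> s"
    and mgf: "(\<integral>\<^sup>+t. ennreal (exp (s * t)) * indicator {..x / 2} t \<partial>F) \<le> ennreal (1 + D)"
  shows "measure M {\<omega> \<in> no_jump_above {1..n} (x / 2). rsum {1..n} \<omega> \<in> shifted_Delta T x} \<le> exp (- s * x) * (1 + D) ^ n"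
proof -
  define A where "A = {\<omega> \<in> no_jump_above {1..n} (x / 2). rsum {1..n} \<omega> \<in> shifted_Delta T x}"
  have bm [measurable]: "no_jump_above {1..n} (x / 2) \<in> sets M" by (rule no_jump_above_measurable) simp
  have "A = no_jump_above {1..n} (x / 2) \<inter> {\<omega> \<in> space M. rsum {1..n} \<omega> \<in> shifted_Delta T x}" by (auto simp: A_def no_jump_above_def)
  then have Am [measurable]: "A \<in> sets M" by simp
  have "ennreal (measure M A) = (\<integral>\<^sup>+\<omega>. indicator A \<omega> \<partial>M)" by (simp add: M.emeasure_eq_measure)
  also have "\<dots> \<le> (\<integral>\<^sup>+\<omega>. ennreal (exp (- s * x)) * (ennreal (exp (s * rsum {1..n} \<omega>)) * indicator (no_jump_above {1..n} (x / 2)) \<omega>) \<partial>M)"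
  proof (rule nn_integral_mono)
    fix \<omega> assume \<omega>: "\<omega> \<in> space M"
    show "indicator A \<omega> \<le> ennreal (exp (- s * x)) * (ennreal (exp (s * rsum {1..n} \<omega>)) * indicator (no_jump_above {1..n} (x / 2)) \<omega>)"
    proof (cases "\<omega> \<in> A")
      case True
      then have 1: "\<omega> \<in> no_jump_above {1..n} (x / 2)" and "x < rsum {1..n} \<omega>" by (simp_all add: A_def mem_shifted_Delta)
      then have "s * x \<le> s * rsum {1..n} \<omega>" using nonneg by (intro mult_left_mono) auto
      then have "1 \<le> exp (- s * x) * exp (s * rsum {1..n} \<omega>)" by (simp flip: exp_add)
      then have "ennreal 1 \<le> ennreal (exp (- s * x) * exp (s * rsum {1..n} \<omega>))" by (rule ennreal_leI)
      then show ?thesis using True 1 by (simp add: ennreal_mult)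
    qed simp
  qed
  also have "\<dots> = ennreal (exp (- s * x)) * (\<integral>\<^sup>+t. ennreal (exp (s * t)) * indicator {..x / 2} t \<partial>F) ^ n"
    by (subst nn_integral_cmult, measurable, subst tilted_sum) simp_all
  also have "\<dots> \<le> ennreal (exp (- s * x)) * ennreal (1 + D) ^ n"
    by (intro mult_left_mono power_mono mgf) simp_all
  also have "\<dots> = ennreal (exp (- s * x) * (1 + D) ^ n)"
    using nonneg ennreal_power[of "1 + D" n] ennreal_mult[of "exp (- s * x)" "(1 + D) ^ n"]
    by (simp del: ennreal_plus)
  finally show ?thesis using nonneg by (simp add: A_def)
qed

text \<open>The tilt s has to match the growth exp(s u) in \<open>bwd\<close>; the tilt s' is chosen
  separately so that exp(-s' x) can be negligible against G x.\<close>

lemma upper_bound: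
  assumes y: "0 < y" "y \<le> x / 2"
    and nonneg: "0 \<le> E" "0 \<le> K" "0 \<le> D" "0 \<le> s" "0 \<le> s'"
    and ins: "\<And>u. \<bar>u\<bar> \<le> y \<Longrightarrow> G (x - u) \<le> E * G x"
    and fwd: "\<And>z. x \<le> z \<Longrightarrow> G z \<le> K * G x"
    and bwd: "\<And>u. 0 \<le> u \<Longrightarrow> u \<le> x / 2 \<Longrightarrow> G (x - u) \<le> K * exp (s * u) * G x"
    and mgf: "(\<integral>\<^sup>+t. ennreal (exp (s * t)) * indicator {..x / 2} t \<partial>F) \<le> ennreal (1 + D)"
    and mgf': "(\<integral>\<^sup>+t. ennreal (exp (s' * t)) * indicator {..x / 2} t \<partial>F) \<le> ennreal (1 + D)"
    and tail: "exp (s * (x / 2)) * measure F {x / 2<..} \<le> D"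
  shows "measure M {\<omega> \<in> space M. rsum {1..n} \<omega> \<in> shifted_Delta T x} \<le> exp (- s' * x) * (1 + D) ^ n +
    real n * (G x * (E + K * (real n / y\<^sup>2 + ((1 + D) ^ n - exp (- s * y) * (1 - real n / y\<^sup>2 - real n * D)) + real n * D)))"
    (is "_ \<le> _ + real n * ?R")
proof -
  define A where "A = {\<omega> \<in> no_jump_above {1..n} (x / 2). rsum {1..n} \<omega> \<in> shifted_Delta T x}"
  define J where "J i = {1..n} - {i}" for i
  define C where "C i = {\<omega> \<in> space M. x / 2 < \<xi> i \<omega> \<and> \<xi> i \<omega> + rsum (J i) \<omega> \<in> shifted_Delta T x}" for i
  have bm [measurable]: "no_jump_above {1..n} (x / 2) \<in> sets M" by (rule no_jump_above_measurable) simp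
  have "A = no_jump_above {1..n} (x / 2) \<inter> {\<omega> \<in> space M. rsum {1..n} \<omega> \<in> shifted_Delta T x}" by (auto simp: A_def no_jump_above_def)
  then have Am [measurable]: "A \<in> sets M" by simp
  have Cm [measurable]: "C i \<in> sets M" for i unfolding C_def by measurable
  have S: "rsum {1..n} \<omega> = \<xi> i \<omega> + rsum (J i) \<omega>" if "i \<in> {1..n}" for i \<omega>
    unfolding J_def using that by (subst sum.remove[of _ i]) auto
  have "{\<omega> \<in> space M. rsum {1..n} \<omega> \<in> shifted_Delta T x} \<subseteq> A \<union> (\<Union>i\<in>{1..n}. C i)"
  proof
    fix \<omega> assume \<omega>: "\<omega> \<in> {\<omega> \<in> space M. rsum {1..n} \<omega> \<in> shifted_Delta T x}"
    show "\<omega> \<in> A \<union> (\<Union>i\<in>{1..n}. C i)"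
    proof (cases "\<omega> \<in> no_jump_above {1..n} (x / 2)")
      case False
      then obtain i where i: "i \<in> {1..n}" "x / 2 < \<xi> i \<omega>" using \<omega> unfolding no_jump_above_def by (auto simp: not_le)
      then have "\<omega> \<in> C i" using \<omega> S[OF i(1), of \<omega>] by (simp add: C_def)
      then show ?thesis using i by blast
    qed (use \<omega> in \<open>simp add: A_def\<close>)
  qed
  then have "measure M {\<omega> \<in> space M. rsum {1..n} \<omega> \<in> shifted_Delta T x} \<le> measure M (A \<union> (\<Union>i\<in>{1..n}. C i))"
    by (rule M.finite_measure_mono) auto
  also have "\<dots> \<le> measure M A + measure M (\<Union>i\<in>{1..n}. C i)"
    by (rule measure_Un_le) auto
  also have "\<dots> \<le> measure M A + (\<Sum>i\<in>{1..n}. measure M (C i))"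
    by (intro add_left_mono M.finite_measure_subadditive_finite) auto
  also have "\<dots> \<le> exp (- s' * x) * (1 + D) ^ n + (\<Sum>i\<in>{1..n}. ?R)"
  proof (intro add_mono sum_mono)
    show "measure M A \<le> exp (- s' * x) * (1 + D) ^ n"
      unfolding A_def using nonneg mgf' by (intro no_big_jump_bound) auto
    fix i assume i: "i \<in> {1..n}"
    show "measure M (C i) \<le> ?R"
      unfolding C_def
      by (rule single_jump_bound[OF _ _ _ y nonneg(1-4) ins fwd bwd mgf tail]) (use i in \<open>auto simp: J_def\<close>)
  qed
  finally show ?thesis by simp
qed

section \<open>Asymptotics along one sequence of levels\<close>

text \<open>All estimates hold for large x only, so they are evaluated along x n. Every error is a
  function of n/L^2 tending to 0, except the insensitivity factor exp \<epsilon> and the ratio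
  treated by \<open>exponential_negligible\<close>.\<close>

lemma big_jump_sequence:
  assumes x: "filterlim x at_top sequentially"
    and ratio: "(\<lambda>n. real n / (ln (x n) powr \<beta>)\<^sup>2) \<longlonglongrightarrow> 0"
  shows "(\<lambda>n. measure M {\<omega> \<in> space M. rsum {1..n} \<omega> \<in> shifted_Delta T (x n)} / (real n * G (x n))) \<longlonglongrightarrow> 1"
proof -
  define L where "L n = ln (x n) powr \<beta>" for n
  define \<rho> where "\<rho> n = real n / (L n)\<^sup>2" for n
  define r where "r n = sqrt (\<rho> n)" for n
  \<comment> \<open>\<open>r = sqrt n / L\<close>, so \<open>y\<close> is the geometric mean of \<open>sqrt n\<close> and \<open>L\<close>.\<close>
  define y where "y n = L n * sqrt (r n)" for n
  define R where "R n = measure M {\<omega> \<in> space M. rsum {1..n} \<omega> \<in> shifted_Delta T (x n)} / (real n * G (x n))" for n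
  have along: "\<forall>\<^sub>F n in sequentially. P (x n)" if "\<forall>\<^sub>F z in at_top. P z" for P
    using filterlim_iff[THEN iffD1, OF x] that by blast
  have \<rho>0: "\<rho> \<longlonglongrightarrow> 0" using ratio by (simp add: \<rho>_def[abs_def] L_def)
  have r0: "r \<longlonglongrightarrow> 0" using tendsto_real_sqrt[OF \<rho>0] by (simp add: r_def[abs_def])
  have sr0: "(\<lambda>n. sqrt (r n)) \<longlonglongrightarrow> 0" using tendsto_real_sqrt[OF r0] by simp
  obtain K1 X1 where K1: "0 < K1" "\<And>x y. X1 \<le> x \<Longrightarrow> x \<le> y \<Longrightarrow> G y \<le> K1 * G x"
    using G_forward_bound by metis
  obtain K2 X2 where K2: "0 < K2"
    "\<And>x y. X2 \<le> x \<Longrightarrow> y \<in> {0..x / 2} \<Longrightarrow> G (x - y) \<le> K2 * exp (c * y / ln x powr \<beta>) * G x"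
    using G_backward_bound by metis
  define K where "K = max K1 K2"
  define \<eta> where "\<eta> = \<beta> * ln 2 / 2"
  have \<eta>: "0 < \<eta>" using \<beta> by (simp add: \<eta>_def)
  obtain C where C: "0 < C" and tilt: "\<forall>\<^sub>F x in at_top. \<forall>s. c / ln x powr \<beta> \<le> s \<longrightarrow>
      s \<le> c / ln x powr \<beta> * (1 + \<eta> / ln x) \<longrightarrow>
    (\<integral>\<^sup>+t. ennreal (exp (s * t)) * indicator {..x / 2} t \<partial>F) \<le> ennreal (1 + C / (ln x powr \<beta>)\<^sup>2) \<and>
    exp (c / ln x powr \<beta> * (x / 2)) * measure F {x / 2<..} \<le> C / (ln x powr \<beta>)\<^sup>2"
    using tilted_bounds unfolding \<eta>_def by blast
  define D where "D n = C / (L n)\<^sup>2" for n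
  define s where "s n = c / L n" for n
  define s' where "s' n = c / L n * (1 + \<eta> / ln (x n))" for n
  \<comment> \<open>The role of n/L^2 tending to 0: n D vanishes, so (1 + D)^n is at most 1 +
    o(1).\<close>
  have nD: "real n * D n = C * \<rho> n" for n by (simp add: D_def \<rho>_def)
  have pow: "(1 + D n) ^ n \<le> exp (C * \<rho> n)" for n
  proof -
    have "(1 + D n) ^ n \<le> exp (D n) ^ n"
      using C by (intro power_mono exp_ge_add_one_self) (simp add: D_def add_nonneg_nonneg)
    then show ?thesis by (simp add: nD flip: exp_of_nat_mult)
  qed
  have ln_gt: "\<forall>\<^sub>F z in at_top. 1 < ln (z::real)" by real_asymp
  have powr_le: "\<forall>\<^sub>F z in at_top. ln z powr \<beta> \<le> z / 2" using \<beta> by real_asymp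
  have basic: "\<forall>\<^sub>F n in sequentially. 0 < real n \<and> 1 < ln (x n) \<and> 0 < L n \<and> 0 < y n \<and> y n \<le> x n / 2
      \<and> real n / (y n)\<^sup>2 = r n \<and> s n * y n = c * sqrt (r n) \<and> 0 < G (x n)"
    using eventually_gt_at_top[of "0::nat"] along[OF ln_gt] along[OF powr_le]
      order_tendstoD(2)[OF sr0 zero_less_one] along[OF G_pos]
  proof eventually_elim
    case (elim n)
    have L: "0 < L n" using elim by (simp add: L_def)
    have r: "0 < r n" "(r n)\<^sup>2 = real n / (L n)\<^sup>2" using elim L by (simp_all add: r_def \<rho>_def)
    have y: "0 < y n" using r L by (simp add: y_def)
    have "y n \<le> L n * 1" unfolding y_def using elim L by (intro mult_left_mono) auto
    then have "y n \<le> x n / 2" using elim by (simp add: L_def)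
    moreover have "real n / (y n)\<^sup>2 = r n"
    proof -
      have "(y n)\<^sup>2 = (L n)\<^sup>2 * r n" using r by (simp add: y_def power_mult_distrib)
      then have "real n / (y n)\<^sup>2 = (real n / (L n)\<^sup>2) / r n" by simp
      also have "\<dots> = r n" using r unfolding r(2)[symmetric] by (simp add: power2_eq_square)
      finally show ?thesis .
    qed
    moreover have "s n * y n = c * sqrt (r n)" using L by (simp add: s_def y_def)
    ultimately show ?case using elim L y by simp
  qed
  have bounds: "\<forall>\<^sub>F n in sequentially. R n \<le>
      exp (C * \<rho> n) * (exp (- s' n * x n) / G (x n)) +
      (exp \<epsilon> + K * (r n + (exp (C * \<rho> n) - exp (- (c * sqrt (r n))) * (1 - r n - C * \<rho> n)) + C * \<rho> n)) \<and>
      (1 - r n - C * \<rho> n) / exp \<epsilon> \<le> R n" if \<epsilon>: "0 < \<epsilon>" for \<epsilon>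
  proof -
    obtain \<delta> where \<delta>: "0 < \<delta>" and insens: "\<forall>\<^sub>F x in at_top. \<forall>y. \<bar>y\<bar> \<le> \<delta> * ln x powr \<beta> \<longrightarrow>
        G (x - y) \<le> exp \<epsilon> * G x \<and> G x \<le> exp \<epsilon> * G (x - y)"
      using G_insensitive[OF \<epsilon>] by blast
    show ?thesis
      using basic along[OF insens] along[OF tilt] along[OF eventually_ge_at_top[of X1]]
        along[OF eventually_ge_at_top[of X2]] order_tendstoD(2)[OF sr0 \<delta>]
    proof eventually_elim
      case (elim n)
      note b = elim(1)
      have L: "0 < L n" "ln (x n) powr \<beta> = L n" using b by (auto simp: L_def)
      have ins: "G (x n - u) \<le> exp \<epsilon> * G (x n)" "G (x n) \<le> exp \<epsilon> * G (x n - u)" if u: "\<bar>u\<bar> \<le> y n" for u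
      proof -
        have "y n \<le> L n * \<delta>" unfolding y_def using L elim(6) by (intro mult_left_mono) auto
        then have "\<bar>u\<bar> \<le> \<delta> * ln (x n) powr \<beta>" using u L by (simp add: mult.commute)
        then show "G (x n - u) \<le> exp \<epsilon> * G (x n)" "G (x n) \<le> exp \<epsilon> * G (x n - u)"
          using elim(2) by blast+
      qed
      have fwd: "G z \<le> K * G (x n)" if "x n \<le> z" for z
      proof -
        have "G z \<le> K1 * G (x n)" by (rule K1(2)[OF elim(4) that])
        also have "\<dots> \<le> K * G (x n)" using b by (intro mult_right_mono) (auto simp: K_def)
        finally show ?thesis .
      qed
      have bwd: "G (x n - u) \<le> K * exp (s n * u) * G (x n)" if "0 \<le> u" "u \<le> x n / 2" for u
      proof -
        have "G (x n - u) \<le> K2 * exp (c * u / ln (x n) powr \<beta>) * G (x n)"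
          using that by (intro K2(2) elim(5)) auto
        also have "\<dots> = K2 * exp (s n * u) * G (x n)" by (simp add: s_def L_def)
        also have "\<dots> \<le> K * exp (s n * u) * G (x n)"
          using b by (intro mult_right_mono) (auto simp: K_def)
        finally show ?thesis .
      qed
      have D: "0 \<le> D n" using C by (simp add: D_def)
      have "s n \<le> s' n"
      proof -
        have "0 \<le> \<eta> / ln (x n)" using \<eta> b by (intro divide_nonneg_pos) linarith+
        then have "c / L n * 1 \<le> c / L n * (1 + \<eta> / ln (x n))"
          using b c by (intro mult_left_mono) auto
        then show ?thesis by (simp add: s_def s'_def)
      qed
      have s'_alt: "s n * (1 + \<eta> / ln (x n)) = s' n" by (simp add: s_def s'_def)
      have T1: "(\<integral>\<^sup>+t. ennreal (exp (s n * t)) * indicator {..x n / 2} t \<partial>F) \<le> ennreal (1 + D n)"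
        and T2: "(\<integral>\<^sup>+t. ennreal (exp (s' n * t)) * indicator {..x n / 2} t \<partial>F) \<le> ennreal (1 + D n)"
        and T3: "exp (s n * (x n / 2)) * measure F {x n / 2<..} \<le> D n"
        using elim(3) \<open>s n \<le> s' n\<close> order_refl[of "s n"] order_refl[of "s' n"]
        unfolding L(2) s_def[symmetric] s'_alt D_def[symmetric] by blast+
      have s: "0 \<le> s n" "0 \<le> s' n" using c L \<open>s n \<le> s' n\<close> by (auto simp: s_def intro: order_trans[of 0 "c / L n"])
      have xn: "0 < x n" using b by linarith
      have nG: "0 < real n * G (x n)" using b by simp
      have K0: "0 \<le> K" using K1 by (simp add: K_def)
      have "measure M {\<omega> \<in> space M. rsum {1..n} \<omega> \<in> shifted_Delta T (x n)} \<le> exp (- s' n * x n) * (1 + D n) ^ n +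
        real n * (G (x n) * (exp \<epsilon> + K * (real n / (y n)\<^sup>2 + ((1 + D n) ^ n - exp (- s n * y n) * (1 - real n / (y n)\<^sup>2 - real n * D n)) + real n * D n)))"
        using b K0 D s T1 T2 T3 by (intro upper_bound ins fwd bwd) auto
      also have "\<dots> \<le> real n * (exp (- s' n * x n) * exp (C * \<rho> n)) +
        real n * (G (x n) * (exp \<epsilon> + K * (r n + (exp (C * \<rho> n) - exp (- (c * sqrt (r n))) * (1 - r n - C * \<rho> n)) + C * \<rho> n)))"
      proof (rule add_mono)
        \<comment> \<open>A crude factor n \<ge> 1 is inserted so that n G can be factored out of
          the whole bound; what remains is the ratio exp(-s' x) / G x.\<close>
        have "exp (- s' n * x n) * (1 + D n) ^ n \<le> 1 * (exp (- s' n * x n) * exp (C * \<rho> n))"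
          using pow[of n] by simp
        also have "\<dots> \<le> real n * (exp (- s' n * x n) * exp (C * \<rho> n))"
          using b by (intro mult_right_mono) auto
        finally show "exp (- s' n * x n) * (1 + D n) ^ n \<le> real n * (exp (- s' n * x n) * exp (C * \<rho> n))" .
        have sy: "- s n * y n = - (c * sqrt (r n))" and ry: "real n / (y n)\<^sup>2 = r n" using b by simp_all
        show "real n * (G (x n) * (exp \<epsilon> + K * (real n / (y n)\<^sup>2 + ((1 + D n) ^ n - exp (- s n * y n) * (1 - real n / (y n)\<^sup>2 - real n * D n)) + real n * D n)))
          \<le> real n * (G (x n) * (exp \<epsilon> + K * (r n + (exp (C * \<rho> n) - exp (- (c * sqrt (r n))) * (1 - r n - C * \<rho> n)) + C * \<rho> n)))"
          unfolding sy ry nD using b K0 pow[of n] by (intro mult_left_mono add_mono diff_mono order_refl) auto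
      qed
      also have "\<dots> = (real n * G (x n)) * (exp (C * \<rho> n) * (exp (- s' n * x n) / G (x n)) +
        (exp \<epsilon> + K * (r n + (exp (C * \<rho> n) - exp (- (c * sqrt (r n))) * (1 - r n - C * \<rho> n)) + C * \<rho> n)))"
        (is "_ = _ * ?B")
        using b by (simp add: distrib_left)
      finally have upper: "R n \<le> ?B"
        unfolding R_def using nG by (simp add: pos_divide_le_eq mult.commute)
      have "measure F {x n / 2<..} \<le> D n"
      proof -
        have "1 * measure F {x n / 2<..} \<le> exp (s n * (x n / 2)) * measure F {x n / 2<..}"
          using s xn by (intro mult_right_mono) auto
        then show ?thesis using T3 by simp
      qed
      then have "1 - r n - C * \<rho> n \<le> 1 - real n / (y n)\<^sup>2 - real n * measure F {x n / 2<..}"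
        using b nD[of n] mult_left_mono[of "measure F {x n / 2<..}" "D n" "real n"] by simp
      then have "real n * (G (x n) / exp \<epsilon>) * (1 - r n - C * \<rho> n) \<le>
          real n * (G (x n) / exp \<epsilon>) * (1 - real n / (y n)\<^sup>2 - real n * measure F {x n / 2<..})"
        using b by (intro mult_left_mono) auto
      also have "\<dots> \<le> measure M {\<omega> \<in> space M. rsum {1..n} \<omega> \<in> shifted_Delta T (x n)}"
        using b by (intro lower_bound ins) auto
      finally have "(1 - r n - C * \<rho> n) / exp \<epsilon> \<le> R n"
        unfolding R_def using nG by (simp add: pos_le_divide_eq mult_ac)
      with upper show ?case by simp
    qed
  qed
  have neg: "(\<lambda>n. exp (- s' n * x n) / G (x n)) \<longlonglongrightarrow> 0"
    using filterlim_compose[OF exponential_negligible[OF \<eta>] x] by (simp add: s'_def L_def)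
  \<comment> \<open>With \<epsilon> fixed all other errors vanish as n grows; \<epsilon> is sent to
    0 only afterwards.\<close>
  have near: "\<forall>\<^sub>F n in sequentially. R n \<le> exp \<epsilon> + \<epsilon> \<and> 1 / exp \<epsilon> - \<epsilon> \<le> R n" if \<epsilon>: "0 < \<epsilon>" for \<epsilon>
  proof -
    have "(\<lambda>n. exp (C * \<rho> n) * (exp (- s' n * x n) / G (x n)) +
      (exp \<epsilon> + K * (r n + (exp (C * \<rho> n) - exp (- (c * sqrt (r n))) * (1 - r n - C * \<rho> n)) + C * \<rho> n)))
      \<longlonglongrightarrow> exp (C * 0) * 0 + (exp \<epsilon> + K * (0 + (exp (C * 0) - exp (- (c * 0)) * (1 - 0 - C * 0)) + C * 0))"
      by (intro tendsto_intros neg \<rho>0 r0 sr0)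
    then have "\<forall>\<^sub>F n in sequentially. exp (C * \<rho> n) * (exp (- s' n * x n) / G (x n)) +
      (exp \<epsilon> + K * (r n + (exp (C * \<rho> n) - exp (- (c * sqrt (r n))) * (1 - r n - C * \<rho> n)) + C * \<rho> n)) < exp \<epsilon> + \<epsilon>"
      by (rule order_tendstoD(2)) (use \<epsilon> in simp)
    moreover have "(\<lambda>n. (1 - r n - C * \<rho> n) / exp \<epsilon>) \<longlonglongrightarrow> (1 - 0 - C * 0) / exp \<epsilon>"
      by (intro tendsto_intros \<rho>0 r0) simp
    then have "\<forall>\<^sub>F n in sequentially. 1 / exp \<epsilon> - \<epsilon> < (1 - r n - C * \<rho> n) / exp \<epsilon>"
      by (rule order_tendstoD(1)) (use \<epsilon> in simp)
    ultimately show ?thesis using bounds[OF \<epsilon>]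
      by eventually_elim linarith
  qed
  have "R \<longlonglongrightarrow> 1"
  proof (rule order_tendstoI)
    fix a :: real assume a: "1 < a"
    have "((\<lambda>\<epsilon>. exp \<epsilon> + \<epsilon>) \<longlongrightarrow> exp 0 + 0) (at_right (0::real))" by (intro tendsto_intros)
    then have "\<forall>\<^sub>F \<epsilon> in at_right (0::real). exp \<epsilon> + \<epsilon> < a" by (rule order_tendstoD(2)) (use a in simp)
    then have "\<forall>\<^sub>F \<epsilon> in at_right (0::real). 0 < \<epsilon> \<and> exp \<epsilon> + \<epsilon> < a"
      using eventually_at_right_less[of 0] by eventually_elim simp
    then obtain \<epsilon> :: real where \<epsilon>: "0 < \<epsilon>" "exp \<epsilon> + \<epsilon> < a"
      using eventually_happens'[OF trivial_limit_at_right_real] by blast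
    show "\<forall>\<^sub>F n in sequentially. R n < a" using near[OF \<epsilon>(1)] by eventually_elim (use \<epsilon> in linarith)
  next
    fix a :: real assume a: "a < 1"
    have "((\<lambda>\<epsilon>. 1 / exp \<epsilon> - \<epsilon>) \<longlongrightarrow> 1 / exp 0 - 0) (at_right (0::real))" by (intro tendsto_intros) simp
    then have "\<forall>\<^sub>F \<epsilon> in at_right (0::real). a < 1 / exp \<epsilon> - \<epsilon>" by (rule order_tendstoD(1)) (use a in simp)
    then have "\<forall>\<^sub>F \<epsilon> in at_right (0::real). 0 < \<epsilon> \<and> a < 1 / exp \<epsilon> - \<epsilon>"
      using eventually_at_right_less[of 0] by eventually_elim simp
    then obtain \<epsilon> :: real where \<epsilon>: "0 < \<epsilon>" "a < 1 / exp \<epsilon> - \<epsilon>"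
      using eventually_happens'[OF trivial_limit_at_right_real] by blast
    show "\<forall>\<^sub>F n in sequentially. a < R n" using near[OF \<epsilon>(1)] by eventually_elim (use \<epsilon> in linarith)
  qed
  then show ?thesis by (simp add: R_def[abs_def])
qed

end

section \<open>Uniformity in x by following nearly worst levels\<close>

theorem theorem8p4:
  fixes M :: "'a measure" and \<xi> :: "nat \<Rightarrow> 'a \<Rightarrow> real" and F :: "real measure"
    and T :: ereal and p :: "real \<Rightarrow> real" and c \<beta> :: real and xs :: "nat \<Rightarrow> real"
  assumes "iid_with_distribution M \<xi> F"
    and "0 < T"
    and "integrable M (\<xi> 0)" and "(LINT \<omega>|M. \<xi> 0 \<omega>) = 0"
    and "integrable M (\<lambda>\<omega>. (\<xi> 0 \<omega>)\<^sup>2)" and "(LINT \<omega>|M. (\<xi> 0 \<omega>)\<^sup>2) = 1"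
    and "0 < \<beta>" and "0 < c"
    and "intermediate_regularly_varying p"
    and "\<forall>\<^sub>F x in at_top. measure F (shifted_Delta T x) = p x * exp (- c * x * ln x powr (- \<beta>))"
    and "much_greater xs (\<lambda>n. real n powr (1 / (2 * \<beta>)))"
  shows "(\<lambda>n. SUP x\<in>{exp (xs n)..}.
            ereal \<bar>measure M {\<omega> \<in> space M. partial_sum \<xi> n \<omega> \<in> shifted_Delta T x}
                     / (real n * measure F (shifted_Delta T x)) - 1\<bar>)
         \<longlonglongrightarrow> 0"
proof -
  have M: "prob_space M" and indep: "prob_space.indep_vars M (\<lambda>_. borel) \<xi> UNIV"
    and dist: "\<And>i. distr M borel (\<xi> i) = F"
    using assms(1) by (auto simp: iid_with_distribution_def)
  interpret M: prob_space M by (rule M)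
  have rv: "\<xi> i \<in> borel_measurable M" for i using indep by (simp add: M.indep_vars_def)
  have id_m: "(\<lambda>t::real. t) \<in> borel_measurable borel" and sq_m: "(\<lambda>t::real. t\<^sup>2) \<in> borel_measurable borel" by simp_all
  interpret iid_semiexponential F T p c \<beta> M \<xi>
  proof (intro iid_semiexponential.intro semiexponential.intro iid_semiexponential_axioms.intro)
    show "prob_space F" unfolding dist[of 0, symmetric] by (rule M.prob_space_distr[OF rv])
    show "sets F = sets borel" unfolding dist[of 0, symmetric] by simp
    show "integrable F (\<lambda>t. t)" "(LINT t|F. t) = 0"
      unfolding dist[of 0, symmetric] integrable_distr_eq[OF rv id_m] integral_distr[OF rv id_m]
      using assms(3,4) by simp_all
    show "integrable F (\<lambda>t. t\<^sup>2)" "(LINT t|F. t\<^sup>2) = 1"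
      unfolding dist[of 0, symmetric] integrable_distr_eq[OF rv sq_m] integral_distr[OF rv sq_m]
      using assms(5,6) by simp_all
  qed (fact assms indep dist M)+
  define v where "v n x = \<bar>measure M {\<omega> \<in> space M. partial_sum \<xi> n \<omega> \<in> shifted_Delta T x}
                     / (real n * measure F (shifted_Delta T x)) - 1\<bar>" for n x
  have xs_pos: "\<forall>\<^sub>F n in sequentially. 0 < xs n"
    and xs_lim: "(\<lambda>n. real n powr (1 / (2 * \<beta>)) / xs n) \<longlonglongrightarrow> 0"
    using assms(11) by (auto simp: much_greater_def)
  have "filterlim (\<lambda>n. real n powr (1 / (2 * \<beta>))) at_top sequentially" using \<beta> by real_asymp
  moreover have "\<forall>\<^sub>F n in sequentially. real n powr (1 / (2 * \<beta>)) \<le> xs n"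
    using xs_pos order_tendstoD(2)[OF xs_lim zero_less_one] by eventually_elim simp
  ultimately have xs_top: "filterlim xs at_top sequentially" by (rule filterlim_at_top_mono)
  have unif: "\<forall>\<^sub>F n in sequentially. \<forall>x\<ge>exp (xs n). v n x \<le> e" if e: "0 < e" for e
  proof -
    \<comment> \<open>Uniformity in \<open>x\<close> from the sequential statement: follow violating points where they exist.\<close>
    define x where "x n = (if \<exists>z\<ge>exp (xs n). e < v n z then SOME z. exp (xs n) \<le> z \<and> e < v n z else exp (xs n))" for n
    have bad: "exp (xs n) \<le> x n \<and> e < v n (x n)" if "\<exists>z\<ge>exp (xs n). e < v n z" for n
      using that someI_ex[of "\<lambda>z. exp (xs n) \<le> z \<and> e < v n z"] by (simp add: x_def)
    have x_ge: "exp (xs n) \<le> x n" for n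
    proof (cases "\<exists>z\<ge>exp (xs n). e < v n z")
      case False
      then have "x n = exp (xs n)" unfolding x_def by (rule if_not_P)
      then show ?thesis by simp
    qed (use bad in blast)
    have x_top: "filterlim x at_top sequentially"
      by (rule filterlim_at_top_mono[OF filterlim_compose[OF exp_at_top xs_top]]) (simp add: x_ge)
    \<comment> \<open>The growth condition on \<open>xs\<close> in the form used: L \<ge> xs^\<beta>
      gives n/L^2 \<le> (n^(1/(2\<beta>)) / xs)^(2\<beta>).\<close>
    have "(\<lambda>n. real n / (ln (x n) powr \<beta>)\<^sup>2) \<longlonglongrightarrow> 0"
    proof (rule Lim_null_comparison)
      show "(\<lambda>n. (real n powr (1 / (2 * \<beta>)) / xs n) powr (2 * \<beta>)) \<longlonglongrightarrow> 0"
      proof (rule tendsto_zero_powrI[OF xs_lim tendsto_const])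
        show "\<forall>\<^sub>F n in sequentially. 0 \<le> real n powr (1 / (2 * \<beta>)) / xs n"
          using xs_pos by eventually_elim simp
      qed (use \<beta> in simp)
      show "\<forall>\<^sub>F n in sequentially. norm (real n / (ln (x n) powr \<beta>)\<^sup>2) \<le> (real n powr (1 / (2 * \<beta>)) / xs n) powr (2 * \<beta>)"
        using xs_pos
      proof eventually_elim
        case (elim n)
        have "0 < x n" using x_ge[of n] exp_gt_zero[of "xs n"] by linarith
        then have "xs n \<le> ln (x n)" using x_ge[of n] by (simp add: ln_ge_iff)
        then have "xs n powr (2 * \<beta>) \<le> ln (x n) powr (2 * \<beta>)" using elim \<beta> by (intro powr_mono2) auto
        also have "\<dots> = (ln (x n) powr \<beta>)\<^sup>2" by (simp add: power2_eq_square flip: powr_add)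
        finally have "real n / (ln (x n) powr \<beta>)\<^sup>2 \<le> real n / xs n powr (2 * \<beta>)"
          using elim by (intro divide_left_mono mult_pos_pos) (auto intro: less_le_trans)
        also have "\<dots> = (real n powr (1 / (2 * \<beta>)) / xs n) powr (2 * \<beta>)"
          using elim \<beta> by (simp add: powr_divide powr_powr)
        finally show ?case by simp
      qed
    qed
    then have "(\<lambda>n. measure M {\<omega> \<in> space M. rsum {1..n} \<omega> \<in> shifted_Delta T (x n)} / (real n * G (x n)) - 1) \<longlonglongrightarrow> 1 - 1"
      by (intro tendsto_intros big_jump_sequence x_top)
    then have "(\<lambda>n. v n (x n)) \<longlonglongrightarrow> 0"
      unfolding v_def partial_sum_def G_def by (intro tendsto_rabs_zero) simp
    then have "\<forall>\<^sub>F n in sequentially. v n (x n) < e" by (rule order_tendstoD(2)) (rule e)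
    then show ?thesis
    proof eventually_elim
      case (elim n)
      show ?case using bad[of n] elim by (meson not_le order.asym)
    qed
  qed
  have "(\<lambda>n. SUP x\<in>{exp (xs n)..}. ereal (v n x)) \<longlonglongrightarrow> 0"
  proof (rule order_tendstoI)
    fix a :: ereal assume "a < 0"
    also have "0 \<le> ereal (v n (exp (xs n)))" for n by (simp add: v_def)
    also have "ereal (v n (exp (xs n))) \<le> (SUP x\<in>{exp (xs n)..}. ereal (v n x))" for n by (rule SUP_upper) simp
    finally show "\<forall>\<^sub>F n in sequentially. a < (SUP x\<in>{exp (xs n)..}. ereal (v n x))" by simp
  next
    fix a :: ereal assume "0 < a"
    then obtain e where e: "0 < ereal e" "ereal e < a" using ereal_dense2[of 0 a] by (auto simp: zero_ereal_def)
    then have "\<forall>\<^sub>F n in sequentially. \<forall>x\<ge>exp (xs n). v n x \<le> e" by (intro unif) simp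
    then show "\<forall>\<^sub>F n in sequentially. (SUP x\<in>{exp (xs n)..}. ereal (v n x)) < a"
    proof eventually_elim
      case (elim n)
      have "(SUP x\<in>{exp (xs n)..}. ereal (v n x)) \<le> ereal e" using elim by (intro SUP_least) simp
      then show ?case using e by simp
    qed
  qed
  then show ?thesis unfolding v_def .
qed

end
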